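(* Let $M,N$ be complete $\tau$-structures with $M\equiv N$ (i.e. $\sigma^M=\sigma^N$ for every linear sentence $\sigma$ of $\tau$). Then there are charge spaces $(I,\mathscr A,\mu)$ and $(J,\mathscr B,\nu)$ such that $M$ is $\mathscr A$-meanable, $N$ is $\mathscr B$-meanable, and $M^{\mu}\simeq N^{\nu}$ (isomorphic as $\tau$-structures).
   Context: Logic. A modulus is an increasing continuous concave function $\lambda:[0,\infty)\to[0,\infty)$ with $\lambda(0)=0$; a map $f$ between metric spaces is $\lambda$-continuous if $d(f(x),f(y))\le\lambda(d(x,y))$ for all $x,y$. A signature $\tau$ is a set of function, relation and constant symbols; each function symbol $F$ has a modulus $\lambda_F$, each relation symbol $R$ has a modulus $\lambda_R$ and a bound $\mathbf b_R\ge0$; $\tau$ contains a distinguished binary relation symbol $d$ with $\mathbf b_d=1$. A $\tau$-structure is a (not necessarily complete) metric space $(M,d)$ with $d$ interpreted as the metric (so diameter $\le1$), each $F^M:M^n\to M$ being $\lambda_F$-continuous, each $R^M:M^n\to\mathbb R$ being $\lambda_R$-continuous with $|R^M|\le\mathbf b_R$, where $M^n$ carries the metric $\sum_{i=1}^n d(x_i,y_i)$. $M$ is complete if it is a complete metric space. Linear formulas are built inductively from $r$ ($r\in\mathbb R$), $d(t_1,t_2)$, $R(t_1,\dots,t_n)$ ($t_i$ terms) by $r\phi$, $\phi+\psi$, $\sup_x\phi$, $\inf_x\phi$, and evaluated in $M$ in the obvious way. Sentences are formulas without free variables. An isomorphism is a bijection preserving the metric and all symbols of $\tau$. Charges. A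 charge space $(I,\mathscr A,\mu)$ consists of a set $I$, a Boolean algebra $\mathscr A$ of subsets of $I$ and a finitely additive $\mu:\mathscr A\to[0,\infty)$ with $\mu(I)=1$. Integrals of bounded functions $f:I\to\mathbb R$ with $f^{-1}([u,v))\in\mathscr A$ for all $u<v$ are defined as usual (uniform limits of simple functions). Powermean. $M$ is $\mathscr A$-meanable if for some cardinal $\kappa$ the metric space $M$ has a dense subset of cardinality $\le\kappa$ and $\mathscr A$ is $\kappa^+$-complete (closed under unions of at most $\kappa$ members). A map $a:I\to M$ is measurable if $a^{-1}(X)\in\mathscr A$ for every Borel $X\subseteq M$. If $M$ is $\mathscr A$-meanable, $M^\mu$ is the set of classes $[a_i]$ of measurable maps $a=(a_i)_{i\in I}$ modulo $a\sim b\iff\int d(a_i,b_i)\,d\mu=0$, with metric $d([a_i],[b_i])=\int d(a_i,b_i)\,d\mu$, $c^{M^\mu}=[c^M]$, $F^{M^\mu}([a_i],\dots)=[F^M(a_i,\dots)]$, $R^{M^\mu}([a_i],\dots)=\int R^M(a_i,\dots)\,d\mu$; it is a $\tau$-structure. *)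

theory Defs
  imports "HOL-Analysis.Analysis"
begin

unbundle cardinal_syntax

text \<open>Signatures. The metric symbol is one of the relation symbols.\<close>

definition modulus :: "(real \<Rightarrow> real) \<Rightarrow> bool" where
  "modulus l \<longleftrightarrow> l ` {0..} \<subseteq> {0..} \<and> mono_on {0..} l \<and> continuous_on {0..} l \<and>
     concave_on {0..} l \<and> l 0 = 0"

record ('f, 'r, 'c) lsig =
  fsyms :: "'f set"
  rsyms :: "'r set"
  csyms :: "'c set"
  farity :: "'f \<Rightarrow> nat"
  fmod :: "'f \<Rightarrow> real \<Rightarrow> real"
  rarity :: "'r \<Rightarrow> nat"
  rmod :: "'r \<Rightarrow> real \<Rightarrow> real"
  rbound :: "'r \<Rightarrow> real"
  dsym :: 'r

definition is_signature :: "('f, 'r, 'c) lsig \<Rightarrow> bool" where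
  "is_signature \<tau> \<longleftrightarrow>
     (\<forall>F \<in> fsyms \<tau>. modulus (fmod \<tau> F)) \<and>
     (\<forall>R \<in> rsyms \<tau>. modulus (rmod \<tau> R) \<and> 0 \<le> rbound \<tau> R) \<and>
     dsym \<tau> \<in> rsyms \<tau> \<and> rarity \<tau> (dsym \<tau>) = 2 \<and> rbound \<tau> (dsym \<tau>) = 1"

text \<open>Structures. Tuples are lists whose length is the arity of the symbol.\<close>

record ('a, 'f, 'r, 'c) struct =
  carr :: "'a set"
  fint :: "'f \<Rightarrow> 'a list \<Rightarrow> 'a"
  rint :: "'r \<Rightarrow> 'a list \<Rightarrow> real"
  cint :: "'c \<Rightarrow> 'a"

text \<open>The metric is the interpretation of the metric symbol. It is set to 0 off the carrier because
  \<^locale>\<open>Metric_space\<close> asks for symmetry and nonnegativity on the whole type.\<close>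

definition sdist :: "('f, 'r, 'c) lsig \<Rightarrow> ('a, 'f, 'r, 'c) struct \<Rightarrow> 'a \<Rightarrow> 'a \<Rightarrow> real" where
  "sdist \<tau> M x y = (if x \<in> carr M \<and> y \<in> carr M then rint M (dsym \<tau>) [x, y] else 0)"

definition tuples :: "('a, 'f, 'r, 'c) struct \<Rightarrow> nat \<Rightarrow> 'a list set" where
  "tuples M n = {xs. length xs = n \<and> set xs \<subseteq> carr M}"

definition tdist :: "('f, 'r, 'c) lsig \<Rightarrow> ('a, 'f, 'r, 'c) struct \<Rightarrow> 'a list \<Rightarrow> 'a list \<Rightarrow> real" where
  "tdist \<tau> M xs ys = (\<Sum>i<length xs. sdist \<tau> M (xs ! i) (ys ! i))"

definition is_structure :: "('f, 'r, 'c) lsig \<Rightarrow> ('a, 'f, 'r, 'c) struct \<Rightarrow> bool" where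
  "is_structure \<tau> M \<longleftrightarrow>
     carr M \<noteq> {} \<and> Metric_space (carr M) (sdist \<tau> M) \<and>
     (\<forall>c \<in> csyms \<tau>. cint M c \<in> carr M) \<and>
     (\<forall>F \<in> fsyms \<tau>. \<forall>xs \<in> tuples M (farity \<tau> F). fint M F xs \<in> carr M) \<and>
     (\<forall>F \<in> fsyms \<tau>. \<forall>xs \<in> tuples M (farity \<tau> F). \<forall>ys \<in> tuples M (farity \<tau> F).
        sdist \<tau> M (fint M F xs) (fint M F ys) \<le> fmod \<tau> F (tdist \<tau> M xs ys)) \<and>
     (\<forall>R \<in> rsyms \<tau>. \<forall>xs \<in> tuples M (rarity \<tau> R). \<bar>rint M R xs\<bar> \<le> rbound \<tau> R) \<and>
     (\<forall>R \<in> rsyms \<tau>. \<forall>xs \<in> tuples M (rarity \<tau> R). \<forall>ys \<in> tuples M (rarity \<tau> R).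
        \<bar>rint M R xs - rint M R ys\<bar> \<le> rmod \<tau> R (tdist \<tau> M xs ys))"

definition complete_structure :: "('f, 'r, 'c) lsig \<Rightarrow> ('a, 'f, 'r, 'c) struct \<Rightarrow> bool" where
  "complete_structure \<tau> M \<longleftrightarrow> is_structure \<tau> M \<and> Metric_space.mcomplete (carr M) (sdist \<tau> M)"

definition isomorphic_structures ::
  "('f, 'r, 'c) lsig \<Rightarrow> ('a, 'f, 'r, 'c) struct \<Rightarrow> ('b, 'f, 'r, 'c) struct \<Rightarrow> bool" where
  "isomorphic_structures \<tau> M N \<longleftrightarrow>
     (\<exists>h. bij_betw h (carr M) (carr N) \<and>
        (\<forall>x \<in> carr M. \<forall>y \<in> carr M. sdist \<tau> N (h x) (h y) = sdist \<tau> M x y) \<and>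
        (\<forall>c \<in> csyms \<tau>. h (cint M c) = cint N c) \<and>
        (\<forall>F \<in> fsyms \<tau>. \<forall>xs \<in> tuples M (farity \<tau> F). h (fint M F xs) = fint N F (map h xs)) \<and>
        (\<forall>R \<in> rsyms \<tau>. \<forall>xs \<in> tuples M (rarity \<tau> R). rint N R (map h xs) = rint M R xs))"

text \<open>Linear formulas. Atomic formulas \<open>d(t\<^sub>1, t\<^sub>2)\<close> are the instances of \<open>Rel\<close>
  at the metric symbol.\<close>

datatype ('f, 'c) ltm = Var nat | Const 'c | App 'f "('f, 'c) ltm list"

datatype ('f, 'r, 'c) lfm =
    Num real
  | Rel 'r "('f, 'c) ltm list"
  | Scale real "('f, 'r, 'c) lfm"
  | Plus "('f, 'r, 'c) lfm" "('f, 'r, 'c) lfm"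
  | SupQ nat "('f, 'r, 'c) lfm"
  | InfQ nat "('f, 'r, 'c) lfm"

fun tm_ok :: "('f, 'r, 'c) lsig \<Rightarrow> ('f, 'c) ltm \<Rightarrow> bool" where
  "tm_ok \<tau> (Var n) = True"
| "tm_ok \<tau> (Const c) = (c \<in> csyms \<tau>)"
| "tm_ok \<tau> (App F ts) = (F \<in> fsyms \<tau> \<and> length ts = farity \<tau> F \<and> (\<forall>t \<in> set ts. tm_ok \<tau> t))"

fun fm_ok :: "('f, 'r, 'c) lsig \<Rightarrow> ('f, 'r, 'c) lfm \<Rightarrow> bool" where
  "fm_ok \<tau> (Num r) = True"
| "fm_ok \<tau> (Rel R ts) = (R \<in> rsyms \<tau> \<and> length ts = rarity \<tau> R \<and> (\<forall>t \<in> set ts. tm_ok \<tau> t))"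
| "fm_ok \<tau> (Scale r p) = fm_ok \<tau> p"
| "fm_ok \<tau> (Plus p q) = (fm_ok \<tau> p \<and> fm_ok \<tau> q)"
| "fm_ok \<tau> (SupQ n p) = fm_ok \<tau> p"
| "fm_ok \<tau> (InfQ n p) = fm_ok \<tau> p"

fun tm_vars :: "('f, 'c) ltm \<Rightarrow> nat set" where
  "tm_vars (Var n) = {n}"
| "tm_vars (Const c) = {}"
| "tm_vars (App F ts) = (\<Union>t \<in> set ts. tm_vars t)"

fun free_vars :: "('f, 'r, 'c) lfm \<Rightarrow> nat set" where
  "free_vars (Num r) = {}"
| "free_vars (Rel R ts) = (\<Union>t \<in> set ts. tm_vars t)"
| "free_vars (Scale r p) = free_vars p"
| "free_vars (Plus p q) = free_vars p \<union> free_vars q"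
| "free_vars (SupQ n p) = free_vars p - {n}"
| "free_vars (InfQ n p) = free_vars p - {n}"

fun tm_val :: "('a, 'f, 'r, 'c) struct \<Rightarrow> (nat \<Rightarrow> 'a) \<Rightarrow> ('f, 'c) ltm \<Rightarrow> 'a" where
  "tm_val M e (Var n) = e n"
| "tm_val M e (Const c) = cint M c"
| "tm_val M e (App F ts) = fint M F (map (tm_val M e) ts)"

fun fm_val :: "('a, 'f, 'r, 'c) struct \<Rightarrow> (nat \<Rightarrow> 'a) \<Rightarrow> ('f, 'r, 'c) lfm \<Rightarrow> real" where
  "fm_val M e (Num r) = r"
| "fm_val M e (Rel R ts) = rint M R (map (tm_val M e) ts)"
| "fm_val M e (Scale r p) = r * fm_val M e p"
| "fm_val M e (Plus p q) = fm_val M e p + fm_val M e q"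
| "fm_val M e (SupQ n p) = (SUP x \<in> carr M. fm_val M (e(n := x)) p)"
| "fm_val M e (InfQ n p) = (INF x \<in> carr M. fm_val M (e(n := x)) p)"

definition sentence :: "('f, 'r, 'c) lsig \<Rightarrow> ('f, 'r, 'c) lfm \<Rightarrow> bool" where
  "sentence \<tau> p \<longleftrightarrow> fm_ok \<tau> p \<and> free_vars p = {}"

text \<open>By \<open>fm_val_sentence\<close> below, the assignment used here is immaterial.\<close>

definition sent_val :: "('a, 'f, 'r, 'c) struct \<Rightarrow> ('f, 'r, 'c) lfm \<Rightarrow> real" where
  "sent_val M p = fm_val M (\<lambda>_. SOME x. x \<in> carr M) p"

definition elem_equiv ::
  "('f, 'r, 'c) lsig \<Rightarrow> ('a, 'f, 'r, 'c) struct \<Rightarrow> ('b, 'f, 'r, 'c) struct \<Rightarrow> bool" where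
  "elem_equiv \<tau> M N \<longleftrightarrow> (\<forall>p. sentence \<tau> p \<longrightarrow> sent_val M p = sent_val N p)"

lemma tm_val_cong: "(\<And>n. n \<in> tm_vars t \<Longrightarrow> e n = e' n) \<Longrightarrow> tm_val M e t = tm_val M e' t"
proof (induction t)
  case (App F ts)
  have "map (tm_val M e) ts = map (tm_val M e') ts"
    using App by (intro map_cong) auto
  then show ?case by (simp only: tm_val.simps)
qed auto

lemma fm_val_cong: "(\<And>n. n \<in> free_vars p \<Longrightarrow> e n = e' n) \<Longrightarrow> fm_val M e p = fm_val M e' p"
proof (induction p arbitrary: e e')
  case (Rel R ts)
  have "map (tm_val M e) ts = map (tm_val M e') ts"
    using Rel by (intro map_cong tm_val_cong) auto
  then show ?case by (simp only: fm_val.simps)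
next
  case (Plus p q)
  then have "fm_val M e p = fm_val M e' p" "fm_val M e q = fm_val M e' q"
    by (metis UnCI free_vars.simps(4))+
  then show ?case by simp
next
  case (SupQ n p)
  then have "fm_val M (e(n := x)) p = fm_val M (e'(n := x)) p" for x
    by (intro SupQ.IH) auto
  then show ?case by simp
next
  case (InfQ n p)
  then have "fm_val M (e(n := x)) p = fm_val M (e'(n := x)) p" for x
    by (intro InfQ.IH) auto
  then show ?case by simp
next
  case (Scale r p)
  then show ?case by (metis fm_val.simps(3) free_vars.simps(3))
qed auto

lemma fm_val_sentence: "sentence \<tau> p \<Longrightarrow> fm_val M e p = sent_val M p"
  unfolding sent_val_def sentence_def by (intro fm_val_cong) auto

text \<open>Charge spaces and integration.\<close>

definition charge_space :: "'i set \<Rightarrow> 'i set set \<Rightarrow> ('i set \<Rightarrow> real) \<Rightarrow> bool" where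
  "charge_space I A \<mu> \<longleftrightarrow> algebra I A \<and> (\<forall>X \<in> A. 0 \<le> \<mu> X) \<and>
     (\<forall>X \<in> A. \<forall>Y \<in> A. X \<inter> Y = {} \<longrightarrow> \<mu> (X \<union> Y) = \<mu> X + \<mu> Y) \<and> \<mu> I = 1"

definition simple_fun :: "'i set \<Rightarrow> 'i set set \<Rightarrow> ('i \<Rightarrow> real) \<Rightarrow> bool" where
  "simple_fun I A s \<longleftrightarrow> finite (s ` I) \<and> (\<forall>r. {i \<in> I. s i = r} \<in> A)"

definition simple_int :: "'i set \<Rightarrow> ('i set \<Rightarrow> real) \<Rightarrow> ('i \<Rightarrow> real) \<Rightarrow> real" where
  "simple_int I \<mu> s = (\<Sum>r \<in> s ` I. r * \<mu> {i \<in> I. s i = r})"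

definition has_charge_int ::
  "'i set \<Rightarrow> 'i set set \<Rightarrow> ('i set \<Rightarrow> real) \<Rightarrow> ('i \<Rightarrow> real) \<Rightarrow> real \<Rightarrow> bool" where
  "has_charge_int I A \<mu> f c \<longleftrightarrow>
     (\<exists>s. (\<forall>n. simple_fun I A (s n)) \<and> uniform_limit I s f sequentially \<and>
        (\<lambda>n. simple_int I \<mu> (s n)) \<longlonglongrightarrow> c)"

definition charge_int ::
  "'i set \<Rightarrow> 'i set set \<Rightarrow> ('i set \<Rightarrow> real) \<Rightarrow> ('i \<Rightarrow> real) \<Rightarrow> real" where
  "charge_int I A \<mu> f = (THE c. has_charge_int I A \<mu> f c)"

lemma charge_finite_sum:
  assumes "charge_space I A \<mu>" "finite K" "\<And>k. k \<in> K \<Longrightarrow> X k \<in> A" "disjoint_family_on X K"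
  shows "(\<Union>k\<in>K. X k) \<in> A \<and> \<mu> (\<Union>k\<in>K. X k) = (\<Sum>k\<in>K. \<mu> (X k))"
  using assms(2-4)
proof (induction K)
  case empty
  have "{} \<in> A" using assms(1) unfolding charge_space_def algebra_iff_Un by auto
  moreover from this have "\<mu> ({} \<union> {}) = \<mu> {} + \<mu> {}"
    using assms(1) unfolding charge_space_def by blast
  ultimately show ?case by simp
next
  case (insert k K)
  have IH: "(\<Union>k\<in>K. X k) \<in> A" "\<mu> (\<Union>k\<in>K. X k) = (\<Sum>k\<in>K. \<mu> (X k))"
    using insert by (auto simp: disjoint_family_on_def)
  have "X k \<inter> (\<Union>k\<in>K. X k) = {}"
    using insert by (auto simp: disjoint_family_on_def)
  then have "\<mu> (X k \<union> (\<Union>k\<in>K. X k)) = \<mu> (X k) + \<mu> (\<Union>k\<in>K. X k)"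
    using assms(1) IH(1) insert.prems(1) unfolding charge_space_def by blast
  moreover have "X k \<union> (\<Union>k\<in>K. X k) \<in> A"
    using assms(1) IH(1) insert.prems(1) unfolding charge_space_def algebra_iff_Un by blast
  ultimately show ?case using insert IH by simp
qed

lemma simple_fun_Int:
  assumes "charge_space I A \<mu>" "simple_fun I A s" "simple_fun I A t"
  shows "{i \<in> I. s i = r \<and> t i = q} \<in> A"
proof -
  have "{i \<in> I. s i = r} \<inter> {i \<in> I. t i = q} \<in> A"
    using assms unfolding charge_space_def simple_fun_def algebra_iff_Int by blast
  moreover have "{i \<in> I. s i = r} \<inter> {i \<in> I. t i = q} = {i \<in> I. s i = r \<and> t i = q}" by auto
  ultimately show ?thesis by simp
qed

lemma simple_fun_split:
  assumes "charge_space I A \<mu>" "simple_fun I A s" "simple_fun I A t"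
  shows "\<mu> {i \<in> I. s i = r} = (\<Sum>q\<in>t ` I. \<mu> {i \<in> I. s i = r \<and> t i = q})"
proof -
  have "\<mu> (\<Union>q\<in>t ` I. {i \<in> I. s i = r \<and> t i = q}) = (\<Sum>q\<in>t ` I. \<mu> {i \<in> I. s i = r \<and> t i = q})"
    using assms(3) by (intro conjunct2[OF charge_finite_sum[OF assms(1)]] simple_fun_Int[OF assms])
      (auto simp: disjoint_family_on_def simple_fun_def)
  moreover have "(\<Union>q\<in>t ` I. {i \<in> I. s i = r \<and> t i = q}) = {i \<in> I. s i = r}" by auto
  ultimately show ?thesis by simp
qed

lemma simple_int_close:
  assumes "charge_space I A \<mu>" "simple_fun I A s" "simple_fun I A t"
    and "\<And>i. i \<in> I \<Longrightarrow> \<bar>s i - t i\<bar> \<le> e"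
  shows "\<bar>simple_int I \<mu> s - simple_int I \<mu> t\<bar> \<le> e"
proof -
  define m where "m r q = \<mu> {i \<in> I. s i = r \<and> t i = q}" for r q
  have s: "simple_int I \<mu> s = (\<Sum>r\<in>s ` I. \<Sum>q\<in>t ` I. r * m r q)"
    using simple_fun_split[OF assms(1-3)]
    by (simp add: m_def simple_int_def sum_distrib_left)
  have "simple_int I \<mu> t = (\<Sum>q\<in>t ` I. \<Sum>r\<in>s ` I. q * m r q)"
    using simple_fun_split[OF assms(1,3,2)]
    by (simp add: m_def simple_int_def sum_distrib_left conj_commute)
  then have t: "simple_int I \<mu> t = (\<Sum>r\<in>s ` I. \<Sum>q\<in>t ` I. q * m r q)"
    by (subst (asm) sum.swap)
  have m0: "0 \<le> m r q" for r q
    using simple_fun_Int[OF assms(1-3)] assms(1) by (simp add: charge_space_def m_def)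
  have tot: "(\<Sum>r\<in>s ` I. \<Sum>q\<in>t ` I. m r q) = 1"
  proof -
    have "\<mu> (\<Union>r\<in>s ` I. {i \<in> I. s i = r}) = (\<Sum>r\<in>s ` I. \<mu> {i \<in> I. s i = r})"
      using assms(2) by (intro conjunct2[OF charge_finite_sum[OF assms(1)]])
        (auto simp: disjoint_family_on_def simple_fun_def)
    moreover have "(\<Union>r\<in>s ` I. {i \<in> I. s i = r}) = I" by auto
    ultimately show ?thesis
      using assms(1) simple_fun_split[OF assms(1-3)] by (simp add: charge_space_def m_def)
  qed
  have b: "\<bar>r * m r q - q * m r q\<bar> \<le> e * m r q" for r q
  proof (cases "\<exists>i \<in> I. s i = r \<and> t i = q")
    case True
    then have "\<bar>r - q\<bar> \<le> e" using assms(4) by auto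
    then have "\<bar>r - q\<bar> * m r q \<le> e * m r q" by (intro mult_right_mono m0)
    moreover have "\<bar>r * m r q - q * m r q\<bar> = \<bar>r - q\<bar> * m r q"
      using m0[of r q] by (simp add: abs_mult flip: left_diff_distrib)
    ultimately show ?thesis by simp
  next
    case False
    then have "{i \<in> I. s i = r \<and> t i = q} = {}" by auto
    moreover have "\<mu> {} = 0" 
      using charge_finite_sum[OF assms(1), of "{}" "\<lambda>_. {}"] by (simp add: disjoint_family_on_def)
    ultimately have "m r q = 0" by (simp only: m_def)
    then show ?thesis by simp
  qed
  have "\<bar>simple_int I \<mu> s - simple_int I \<mu> t\<bar> =
      \<bar>\<Sum>r\<in>s ` I. \<Sum>q\<in>t ` I. (r * m r q - q * m r q)\<bar>"
    by (simp add: s t sum_subtractf)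
  also have "\<dots> \<le> (\<Sum>r\<in>s ` I. \<Sum>q\<in>t ` I. \<bar>r * m r q - q * m r q\<bar>)"
    by (rule order_trans[OF sum_abs]) (intro sum_mono sum_abs)
  also have "\<dots> \<le> (\<Sum>r\<in>s ` I. \<Sum>q\<in>t ` I. e * m r q)"
    by (intro sum_mono b)
  also have "\<dots> = e" using tot by (simp flip: sum_distrib_left)
  finally show ?thesis .
qed

lemma has_charge_int_unique:
  assumes I: "charge_space I A \<mu>" and "has_charge_int I A \<mu> f c" "has_charge_int I A \<mu> f c'"
  shows "c = c'"
proof -
  obtain s where s: "\<And>n. simple_fun I A (s n)" "uniform_limit I s f sequentially"
      "(\<lambda>n. simple_int I \<mu> (s n)) \<longlonglongrightarrow> c"
    using assms(2) unfolding has_charge_int_def by blast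
  obtain t where t: "\<And>n. simple_fun I A (t n)" "uniform_limit I t f sequentially"
      "(\<lambda>n. simple_int I \<mu> (t n)) \<longlonglongrightarrow> c'"
    using assms(3) unfolding has_charge_int_def by blast
  have lim: "(\<lambda>n. simple_int I \<mu> (s n) - simple_int I \<mu> (t n)) \<longlonglongrightarrow> 0"
  proof (rule tendstoI)
    fix e :: real assume "e > 0"
    then have "\<forall>\<^sub>F n in sequentially. \<forall>i\<in>I. dist (s n i) (f i) < e / 4"
        "\<forall>\<^sub>F n in sequentially. \<forall>i\<in>I. dist (t n i) (f i) < e / 4"
      using s(2) t(2) unfolding uniform_limit_iff by (meson divide_pos_pos zero_less_numeral)+
    then show "\<forall>\<^sub>F n in sequentially. dist (simple_int I \<mu> (s n) - simple_int I \<mu> (t n)) 0 < e"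
    proof eventually_elim
      case (elim n)
      have "\<bar>s n i - t n i\<bar> \<le> e / 2" if "i \<in> I" for i
      proof -
        have "dist (s n i) (f i) < e / 4" "dist (t n i) (f i) < e / 4" using elim that by auto
        then show ?thesis unfolding dist_real_def by linarith
      qed
      from simple_int_close[OF I s(1) t(1) this] show ?case using \<open>e > 0\<close> by simp
    qed
  qed
  have "(\<lambda>n. simple_int I \<mu> (s n) - simple_int I \<mu> (t n)) \<longlonglongrightarrow> c - c'"
    by (intro tendsto_diff s t)
  with lim show ?thesis using LIMSEQ_unique by fastforce
qed

lemma charge_int_eqI:
  "charge_space I A \<mu> \<Longrightarrow> has_charge_int I A \<mu> f c \<Longrightarrow> charge_int I A \<mu> f = c"
  unfolding charge_int_def using has_charge_int_unique by (metis the_equality)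

text \<open>Powermeans. Restricting the cardinal \<open>\<kappa>\<close> to the type of the points of \<open>M\<close> loses nothing: it can be
  replaced by the cardinality of the dense subset.\<close>

definition meanable :: "('f, 'r, 'c) lsig \<Rightarrow> ('a, 'f, 'r, 'c) struct \<Rightarrow> 'i set set \<Rightarrow> bool" where
  "meanable \<tau> M A \<longleftrightarrow>
     (\<exists>\<kappa> :: 'a rel. Card_order \<kappa> \<and>
        (\<exists>D \<subseteq> carr M. Metric_space.mtopology (carr M) (sdist \<tau> M) closure_of D = carr M \<and>
           |D| \<le>o \<kappa>) \<and>
        (\<forall>\<X> \<subseteq> A. |\<X>| \<le>o \<kappa> \<longrightarrow> \<Union>\<X> \<in> A))"

definition borel_subsets :: "('f, 'r, 'c) lsig \<Rightarrow> ('a, 'f, 'r, 'c) struct \<Rightarrow> 'a set set" where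
  "borel_subsets \<tau> M =
     sigma_sets (carr M) {U. openin (Metric_space.mtopology (carr M) (sdist \<tau> M)) U}"

definition mmaps ::
  "('f, 'r, 'c) lsig \<Rightarrow> ('a, 'f, 'r, 'c) struct \<Rightarrow> 'i set \<Rightarrow> 'i set set \<Rightarrow> ('i \<Rightarrow> 'a) set" where
  "mmaps \<tau> M I A =
     {a \<in> I \<rightarrow>\<^sub>E carr M. \<forall>X \<in> borel_subsets \<tau> M. {i \<in> I. a i \<in> X} \<in> A}"

definition mrel ::
  "('f, 'r, 'c) lsig \<Rightarrow> ('a, 'f, 'r, 'c) struct \<Rightarrow> 'i set \<Rightarrow> 'i set set \<Rightarrow> ('i set \<Rightarrow> real) \<Rightarrow>
     ('i \<Rightarrow> 'a) rel" where
  "mrel \<tau> M I A \<mu> = {(a, b). a \<in> mmaps \<tau> M I A \<and> b \<in> mmaps \<tau> M I A \<and>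
     charge_int I A \<mu> (\<lambda>i. sdist \<tau> M (a i) (b i)) = 0}"

definition crep :: "('i \<Rightarrow> 'a) set \<Rightarrow> 'i \<Rightarrow> 'a" where
  "crep X = (SOME a. a \<in> X)"

text \<open>The metric needs no separate clause: it is the interpretation of the metric symbol,
  which is \<open>[a], [b] \<mapsto> \<integral> d(a\<^sub>i, b\<^sub>i) d\<mu>\<close>. Operations on classes are computed on chosen
  representatives.\<close>

definition powermean ::
  "('f, 'r, 'c) lsig \<Rightarrow> ('a, 'f, 'r, 'c) struct \<Rightarrow> 'i set \<Rightarrow> 'i set set \<Rightarrow> ('i set \<Rightarrow> real) \<Rightarrow>
     (('i \<Rightarrow> 'a) set, 'f, 'r, 'c) struct" where
  "powermean \<tau> M I A \<mu> =
     \<lparr> carr = mmaps \<tau> M I A // mrel \<tau> M I A \<mu>,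
       fint = (\<lambda>F Xs. mrel \<tau> M I A \<mu> `` {\<lambda>i \<in> I. fint M F (map (\<lambda>X. crep X i) Xs)}),
       rint = (\<lambda>R Xs. charge_int I A \<mu> (\<lambda>i. rint M R (map (\<lambda>X. crep X i) Xs))),
       cint = (\<lambda>c. mrel \<tau> M I A \<mu> `` {\<lambda>i \<in> I. cint M c}) \<rparr>"

text \<open>Existence of a charge space cannot quantify over the type of its index set, so that type has to be
  named. The double power set of \<open>nat + 'a + 'b\<close> is large enough for structures with points in \<open>'a\<close>
  and \<open>'b\<close>: write \<open>K\<close> for the cardinality of \<open>nat + 'a + 'b\<close>. Since \<open>(2^K)^K = 2^K\<close>, a chain of
  length \<open>K\<^sup>+\<close> of powermeans over \<open>K\<^sup>+\<close>-complete algebras generated by \<open>2^K\<close> coordinate maps stays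
  within cardinality \<open>2^K\<close>, so that index sets of functions from a set of size \<open>2^K\<close> to the
  structures suffice.\<close>

type_synonym ('a, 'b) index = "(nat + 'a + 'b) set set"

end

(*
  Let K be the cardinality of nat + 'a + 'b. Index the coordinates by 2^K names, let I and J be the
  sets of finitely supported functions from names to M and to N, and let the algebras consist of the
  sets that depend on at most K coordinates. There are only 2^K measurable maps I -> M, and each
  depends on at most K names, whose ranks below the regular cardinal K^+ are bounded; so every such
  map a can be given a name z of higher rank than the names on which it depends, and likewise on the
  side of N. It suffices to find a positive normalized linear functional on the bounded functions on
  I x J that kills d(X_z, a) for these pairs (on both sides) and R(ts at X) - R(ts at Y) for all
  atomic formulas R(ts): then [X_z] |-> [Y_z] is an isomorphism, since every class is the class of a
  coordinate. By Hahn-Banach such a functional exists as soon as every finite linear combination of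
  these functions is somewhere almost nonnegative. This is a finite game: the coordinates are chosen
  by increasing rank, at each name one side is forced and the other side answers, and the values of
  a prenex linear sentence with the corresponding quantifiers, equal in M and N, show how to answer.
*)

theory Submission
  imports Defs
begin

section \<open>Means on bounded functions\<close>

text \<open>Finite support is what keeps the measurable maps few. Once its support of at most K
  names is listed, a map is determined by its values at the K functions that are finitely supported
  there, which leaves 2^K maps, no more than there are names; on the full product there could be
  2^(2^K). Each name makes its demand on one side only: if both coordinates were forced, no move
  would be left to keep the values in M and N close. A map may depend on infinitely many coordinates
  although the game is finite. The coordinates outside the finite set in play are frozen from the
  start, and playing by increasing rank ensures that no later move disturbs a value already forced.
  Linearity decides which sentences occur: Hahn-Banach only asks about linear combinations, and a
  linear combination of atomic formulas is again a linear formula, so equivalence for linear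
  sentences suffices. The mean lives on the product of the index sets so that one functional induces
  both charges by projection and can compare values in M with values in N.\<close>

definition bdd_funs :: "'s set \<Rightarrow> ('s \<Rightarrow> real) set" where
  "bdd_funs S = {f. \<exists>B. \<forall>s\<in>S. \<bar>f s\<bar> \<le> B}"

lemma bdd_funsI: "(\<And>s. s \<in> S \<Longrightarrow> \<bar>f s\<bar> \<le> B) \<Longrightarrow> f \<in> bdd_funs S"
  unfolding bdd_funs_def by blast

lemma bdd_funsE:
  assumes "f \<in> bdd_funs S"
  obtains B where "0 \<le> B" "\<And>s. s \<in> S \<Longrightarrow> \<bar>f s\<bar> \<le> B"
proof -
  obtain B where "\<forall>s\<in>S. \<bar>f s\<bar> \<le> B" using assms unfolding bdd_funs_def by blast
  then have "\<And>s. s \<in> S \<Longrightarrow> \<bar>f s\<bar> \<le> \<bar>B\<bar>" by fastforce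
  then show thesis using that[of "\<bar>B\<bar>"] by simp
qed

lemma bdd_funs_add [intro]:
  assumes "f \<in> bdd_funs S" "g \<in> bdd_funs S"
  shows "(\<lambda>s. f s + g s) \<in> bdd_funs S"
proof -
  obtain A B where "\<And>s. s \<in> S \<Longrightarrow> \<bar>f s\<bar> \<le> A" "\<And>s. s \<in> S \<Longrightarrow> \<bar>g s\<bar> \<le> B"
    using assms unfolding bdd_funs_def by blast
  then show ?thesis
    by (intro bdd_funsI[of _ _ "A + B"]) (meson abs_triangle_ineq add_mono order_trans)
qed

lemma bdd_funs_scale [intro]:
  assumes "f \<in> bdd_funs S"
  shows "(\<lambda>s. c * f s) \<in> bdd_funs S"
proof -
  obtain B where "\<And>s. s \<in> S \<Longrightarrow> \<bar>f s\<bar> \<le> B" using assms unfolding bdd_funs_def by blast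
  then show ?thesis
    by (intro bdd_funsI[of _ _ "\<bar>c\<bar> * B"]) (simp add: abs_mult mult_left_mono)
qed

lemma bdd_funs_const [intro, simp]: "(\<lambda>_. c) \<in> bdd_funs S"
  by (rule bdd_funsI[of _ _ "\<bar>c\<bar>"]) simp

lemma bdd_funs_minus [intro]: "f \<in> bdd_funs S \<Longrightarrow> (\<lambda>s. - f s) \<in> bdd_funs S"
  using bdd_funs_scale[of f S "-1"] by simp

lemma bdd_funs_diff [intro]:
  "f \<in> bdd_funs S \<Longrightarrow> g \<in> bdd_funs S \<Longrightarrow> (\<lambda>s. f s - g s) \<in> bdd_funs S"
  using bdd_funs_add[OF _ bdd_funs_minus, of f S g] by simp

section \<open>Sublinear functionals and the Hahn-Banach theorem\<close>

definition sublinear_on :: "('s \<Rightarrow> real) set \<Rightarrow> (('s \<Rightarrow> real) \<Rightarrow> real) \<Rightarrow> bool" where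
  "sublinear_on V p \<longleftrightarrow> (\<forall>f\<in>V. \<forall>g\<in>V. p (\<lambda>s. f s + g s) \<le> p f + p g) \<and>
     (\<forall>f\<in>V. \<forall>c>0. p (\<lambda>s. c * f s) \<le> c * p f)"

definition fun_subspace :: "('s \<Rightarrow> real) set \<Rightarrow> bool" where
  "fun_subspace V \<longleftrightarrow> V \<noteq> {} \<and> (\<forall>f\<in>V. \<forall>g\<in>V. (\<lambda>s. f s + g s) \<in> V) \<and>
     (\<forall>f\<in>V. \<forall>c. (\<lambda>s. c * f s) \<in> V)"

lemma fun_subspace_add: "fun_subspace V \<Longrightarrow> f \<in> V \<Longrightarrow> g \<in> V \<Longrightarrow> (\<lambda>s. f s + g s) \<in> V"
  and fun_subspace_scale: "fun_subspace V \<Longrightarrow> f \<in> V \<Longrightarrow> (\<lambda>s. c * f s) \<in> V"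
  by (auto simp: fun_subspace_def)

lemma fun_subspace_zero: "fun_subspace V \<Longrightarrow> (\<lambda>_. 0) \<in> V"
  using fun_subspace_scale[of V _ 0] by (auto simp: fun_subspace_def)

lemma fun_subspace_minus: "fun_subspace V \<Longrightarrow> f \<in> V \<Longrightarrow> (\<lambda>s. - f s) \<in> V"
  using fun_subspace_scale[of V f "-1"] by simp

lemma fun_subspace_bdd_funs: "fun_subspace (bdd_funs S)"
  unfolding fun_subspace_def using bdd_funs_const[of 0 S] by blast

lemma sublinear_on_add:
  "sublinear_on V p \<Longrightarrow> f \<in> V \<Longrightarrow> g \<in> V \<Longrightarrow> p (\<lambda>s. f s + g s) \<le> p f + p g"
  and sublinear_on_scale_le: "sublinear_on V p \<Longrightarrow> f \<in> V \<Longrightarrow> 0 < c \<Longrightarrow> p (\<lambda>s. c * f s) \<le> c * p f"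
  by (auto simp: sublinear_on_def)

lemma sublinear_on_scale:
  assumes "fun_subspace V" "sublinear_on V p" "f \<in> V" "0 < c"
  shows "p (\<lambda>s. c * f s) = c * p f"
proof (rule antisym)
  show "p (\<lambda>s. c * f s) \<le> c * p f" by (rule sublinear_on_scale_le[OF assms(2-4)])
  \<comment> \<open>The reverse inequality is the assumed one for the factor
    \<open>inverse c\<close> and the function \<open>c * f\<close>.\<close>
  have "p (\<lambda>s. inverse c * (c * f s)) \<le> inverse c * p (\<lambda>s. c * f s)"
    using assms by (intro sublinear_on_scale_le[OF assms(2)] fun_subspace_scale) auto
  moreover have "(\<lambda>s. inverse c * (c * f s)) = f" using assms(4) by (simp add: field_simps)
  ultimately show "c * p f \<le> p (\<lambda>s. c * f s)" using assms(4) by (simp add: field_simps)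
qed

lemma sublinear_on_zero:
  assumes "fun_subspace V" "sublinear_on V p"
  shows "p (\<lambda>_. 0) = 0"
  using sublinear_on_scale[OF assms fun_subspace_zero[OF assms(1)], of 2] by simp

text \<open>For a sublinear functional below a fixed \<open>p\<close> this gives the lower bound - p
  (- f), which does not depend on the functional; it makes infima of chains finite.\<close>

lemma sublinear_on_ge:
  assumes "fun_subspace V" "sublinear_on V p" "f \<in> V"
  shows "- p (\<lambda>s. - f s) \<le> p f"
  using sublinear_on_add[OF assms(2,3) fun_subspace_minus[OF assms(1,3)]] sublinear_on_zero[OF assms(1,2)]
  by simp

text \<open>Zorn: the pointwise infimum of a chain of sublinear functionals is again subadditive,
  because of two members of the chain the smaller one serves both summands.\<close>

lemma minimal_sublinear_on:
  assumes V: "fun_subspace V" and p: "sublinear_on V p"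
  shows "\<exists>m. sublinear_on V m \<and> (\<forall>f\<in>V. m f \<le> p f) \<and>
    (\<forall>q. sublinear_on V q \<longrightarrow> (\<forall>f\<in>V. q f \<le> m f) \<longrightarrow> (\<forall>f\<in>V. q f = m f))"
proof -
  \<comment> \<open>The order compares values on \<open>V\<close> only; fixing the values off
    \<open>V\<close> to 0 makes it antisymmetric.\<close>
  define Q where "Q = {q. sublinear_on V q \<and> (\<forall>f\<in>V. q f \<le> p f) \<and> (\<forall>f. f \<notin> V \<longrightarrow> q f = 0)}"
  define cut where "cut q f = (if f \<in> V then q f else 0)" for q :: "('a \<Rightarrow> real) \<Rightarrow> real" and f
  \<comment> \<open>Reversed, so that a maximal element for Zorn is a minimal functional.\<close>
  define R where "R = (\<lambda>a b :: ('a \<Rightarrow> real) \<Rightarrow> real. \<forall>f\<in>V. b f \<le> a f)"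
  have cutV: "f \<in> V \<Longrightarrow> cut q f = q f" for q f by (simp add: cut_def)
  have cut: "cut q \<in> Q" if "sublinear_on V q" "\<And>f. f \<in> V \<Longrightarrow> q f \<le> p f" for q
    using that V unfolding Q_def by (auto simp: sublinear_on_def fun_subspace_def cut_def)
  have "\<exists>m\<in>Q. \<forall>a\<in>Q. R m a \<longrightarrow> a = m"
  proof (rule predicate_Zorn)
    show "partial_order_on Q (relation_of R Q)"
    proof (rule partial_order_on_relation_ofI)
      show "R a c" if "R a b" "R b c" for a b c
        using that unfolding R_def by (blast intro: order_trans)
      show "a = b" if "a \<in> Q" "b \<in> Q" "R a b" "R b a" for a b
      proof
        show "a f = b f" for f using that by (cases "f \<in> V") (auto simp: Q_def R_def intro: antisym)
      qed
    qed (simp add: R_def)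
  next
    fix C assume C: "C \<in> Chains (relation_of R Q)"
    then have CQ: "C \<subseteq> Q" by (auto simp: Chains_def relation_of_def)
    show "\<exists>u\<in>Q. \<forall>a\<in>C. R a u"
    proof (cases "C = {}")
      case True
      then show ?thesis using cut[OF p] by auto
    next
      case False
      define u where "u f = (INF q\<in>C. q f)" for f
      have below: "bdd_below ((\<lambda>q. q f) ` C)" if "f \<in> V" for f
      proof (rule bdd_belowI2[of _ "- p (\<lambda>s. - f s)"])
        fix q assume "q \<in> C"
        then have q: "sublinear_on V q" "\<And>f. f \<in> V \<Longrightarrow> q f \<le> p f" using CQ by (auto simp: Q_def)
        show "- p (\<lambda>s. - f s) \<le> q f"
          using sublinear_on_ge[OF V q(1) that] q(2)[OF fun_subspace_minus[OF V that]] by simp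
      qed
      have u_le: "u f \<le> q f" if "f \<in> V" "q \<in> C" for f q
        unfolding u_def by (rule cINF_lower[OF below[OF that(1)] that(2)])
      have u_ge: "x \<le> u f" if "\<And>q. q \<in> C \<Longrightarrow> x \<le> q f" for x f
        unfolding u_def by (rule cINF_greatest[OF False that])
      have "sublinear_on V u"
        unfolding sublinear_on_def
      proof (intro conjI ballI allI impI)
        fix f g assume fg: "f \<in> V" "g \<in> V"
        have *: "u (\<lambda>s. f s + g s) \<le> a f + b g" if ab: "a \<in> C" "b \<in> C" for a b
        proof -
          from C ab have "R a b \<or> R b a" by (auto simp: Chains_def relation_of_def)
          then obtain c where c: "c \<in> C" "c f \<le> a f" "c g \<le> b g"
            using ab fg unfolding R_def by (metis order_refl)
          have "u (\<lambda>s. f s + g s) \<le> c (\<lambda>s. f s + g s)"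
            using fg V c(1) by (intro u_le fun_subspace_add)
          also have "\<dots> \<le> c f + c g" using c(1) CQ fg by (auto simp: Q_def sublinear_on_def)
          finally show ?thesis using c by simp
        qed
        have "u (\<lambda>s. f s + g s) - u f \<le> b g" if "b \<in> C" for b
          using u_ge[of "u (\<lambda>s. f s + g s) - b g" f] *[OF _ that] by (simp add: algebra_simps)
        then have "u (\<lambda>s. f s + g s) - u f \<le> u g" by (rule u_ge)
        then show "u (\<lambda>s. f s + g s) \<le> u f + u g" by simp
      next
        fix f and c :: real assume fc: "f \<in> V" "0 < c"
        have "u (\<lambda>s. c * f s) / c \<le> u f"
        proof (rule u_ge)
          fix q assume "q \<in> C"
          then have "u (\<lambda>s. c * f s) \<le> q (\<lambda>s. c * f s)" using fc V by (intro u_le fun_subspace_scale)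
          also have "\<dots> \<le> c * q f" using \<open>q \<in> C\<close> CQ fc by (auto simp: Q_def sublinear_on_def)
          finally show "u (\<lambda>s. c * f s) / c \<le> q f" using fc by (simp add: field_simps)
        qed
        then show "u (\<lambda>s. c * f s) \<le> c * u f" using fc by (simp add: field_simps)
      qed
      moreover have "u f \<le> p f" if "f \<in> V" for f
      proof -
        obtain q where "q \<in> C" using False by blast
        then have "u f \<le> q f" "q f \<le> p f" using u_le that CQ by (auto simp: Q_def)
        then show ?thesis by simp
      qed
      ultimately have "cut u \<in> Q" by (rule cut)
      moreover have "R a (cut u)" if "a \<in> C" for a
        using u_le that by (simp add: R_def cutV)
      ultimately show ?thesis by blast
    qed
  qed
  then obtain m where m: "m \<in> Q" "\<And>a. a \<in> Q \<Longrightarrow> R m a \<Longrightarrow> a = m" by blast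
  have "q f = m f" if q: "sublinear_on V q" "\<forall>f\<in>V. q f \<le> m f" "f \<in> V" for q f
  proof -
    have "cut q \<in> Q" using q m(1) by (intro cut) (auto simp: Q_def intro: order_trans)
    then have "cut q = m" using q(2) by (intro m(2)) (auto simp: R_def cutV)
    then show "q f = m f" using cutV[OF q(3), of q] by simp
  qed
  then show ?thesis using m(1) by (intro exI[of _ m]) (auto simp: Q_def)
qed

text \<open>Hahn--Banach: a minimal sublinear functional \<open>m\<close> is additive, since otherwise
  \<open>f \<mapsto> inf\<^sub>t (m (f + t g) - t m g)\<close> would lie below it.\<close>

lemma linear_below_sublinear_on:
  assumes V: "fun_subspace V" and p: "sublinear_on V p"
  shows "\<exists>L. (\<forall>f\<in>V. \<forall>g\<in>V. L (\<lambda>s. f s + g s) = L f + L g) \<and>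
    (\<forall>f\<in>V. \<forall>c. L (\<lambda>s. c * f s) = c * L f) \<and> (\<forall>f\<in>V. L f \<le> p f)"
proof -
  obtain m where m: "sublinear_on V m" "\<forall>f\<in>V. m f \<le> p f"
    and min: "\<forall>q. sublinear_on V q \<longrightarrow> (\<forall>f\<in>V. q f \<le> m f) \<longrightarrow> (\<forall>f\<in>V. q f = m f)"
    using minimal_sublinear_on[OF V p] by blast
  note VI = fun_subspace_add[OF V] fun_subspace_scale[OF V] fun_subspace_minus[OF V]
  have add: "m (\<lambda>s. f s + g s) = m f + m g" if f: "f \<in> V" and g: "g \<in> V" for f g
  proof -
    define q where "q f = (INF t\<in>{0..}. m (\<lambda>s. f s + t * g s) - t * m g)" for f
    have scale: "m (\<lambda>s. t * g s) = t * m g" if "0 \<le> t" for t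
      using sublinear_on_scale[OF V m(1) g] sublinear_on_zero[OF V m(1)] that
      by (cases "t = 0") auto
    have below: "bdd_below ((\<lambda>t. m (\<lambda>s. f s + t * g s) - t * m g) ` {0..})" if f: "f \<in> V" for f
    proof (rule bdd_belowI2[of _ "- m (\<lambda>s. - f s)"])
      fix t :: real assume "t \<in> {0..}"
      moreover have "m (\<lambda>s. (f s + t * g s) + - f s) \<le> m (\<lambda>s. f s + t * g s) + m (\<lambda>s. - f s)"
        using f g by (intro sublinear_on_add[OF m(1)] VI)
      moreover have "(\<lambda>s. (f s + t * g s) + - f s) = (\<lambda>s. t * g s)" by simp
      ultimately show "- m (\<lambda>s. - f s) \<le> m (\<lambda>s. f s + t * g s) - t * m g" using scale[of t] by simp
    qed
    have q_le: "q f \<le> m (\<lambda>s. f s + t * g s) - t * m g" if "f \<in> V" "0 \<le> t" for f t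
      unfolding q_def using that by (intro cINF_lower[OF below]) auto
    have q_ge: "x \<le> q f" if "\<And>t. 0 \<le> t \<Longrightarrow> x \<le> m (\<lambda>s. f s + t * g s) - t * m g" for x f
      unfolding q_def by (rule cINF_greatest) (use that in auto)
    have "sublinear_on V q"
      unfolding sublinear_on_def
    proof (intro conjI ballI allI impI)
      fix f1 f2 assume f12: "f1 \<in> V" "f2 \<in> V"
      \<comment> \<open>The parameters add up: \<open>t1 + t2\<close> is admissible in the infimum
        for the sum, and \<open>m\<close> is subadditive.\<close>
      have *: "q (\<lambda>s. f1 s + f2 s) \<le>
          (m (\<lambda>s. f1 s + t1 * g s) - t1 * m g) + (m (\<lambda>s. f2 s + t2 * g s) - t2 * m g)"
        if t: "0 \<le> t1" "0 \<le> t2" for t1 t2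
      proof -
        have "q (\<lambda>s. f1 s + f2 s) \<le> m (\<lambda>s. (f1 s + f2 s) + (t1 + t2) * g s) - (t1 + t2) * m g"
          using f12 t by (intro q_le VI) auto
        moreover have "m (\<lambda>s. (f1 s + t1 * g s) + (f2 s + t2 * g s)) \<le>
            m (\<lambda>s. f1 s + t1 * g s) + m (\<lambda>s. f2 s + t2 * g s)"
          using f12 g by (intro sublinear_on_add[OF m(1)] VI)
        moreover have "(\<lambda>s. (f1 s + f2 s) + (t1 + t2) * g s) =
            (\<lambda>s. (f1 s + t1 * g s) + (f2 s + t2 * g s))" by (simp add: algebra_simps)
        ultimately show ?thesis by (simp add: algebra_simps)
      qed
      have "q (\<lambda>s. f1 s + f2 s) - q f1 \<le> q f2"
      proof (rule q_ge)
        fix t2 :: real assume t2: "0 \<le> t2"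
        have "q (\<lambda>s. f1 s + f2 s) - (m (\<lambda>s. f2 s + t2 * g s) - t2 * m g) \<le> q f1"
          by (rule q_ge) (use *[OF _ t2] in \<open>simp add: algebra_simps\<close>)
        then show "q (\<lambda>s. f1 s + f2 s) - q f1 \<le> m (\<lambda>s. f2 s + t2 * g s) - t2 * m g" by simp
      qed
      then show "q (\<lambda>s. f1 s + f2 s) \<le> q f1 + q f2" by simp
    next
      fix f and c :: real assume fc: "f \<in> V" "0 < c"
      have "q (\<lambda>s. c * f s) / c \<le> q f"
      proof (rule q_ge)
        fix t :: real assume t: "0 \<le> t"
        have "q (\<lambda>s. c * f s) \<le> m (\<lambda>s. c * f s + (c * t) * g s) - (c * t) * m g"
          using fc t by (intro q_le VI) auto
        also have "(\<lambda>s. c * f s + (c * t) * g s) = (\<lambda>s. c * (f s + t * g s))"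
          by (simp add: algebra_simps)
        also have "m \<dots> = c * m (\<lambda>s. f s + t * g s)"
          using fc g by (intro sublinear_on_scale[OF V m(1)] VI) auto
        finally show "q (\<lambda>s. c * f s) / c \<le> m (\<lambda>s. f s + t * g s) - t * m g"
          using fc by (simp add: field_simps)
      qed
      then show "q (\<lambda>s. c * f s) \<le> c * q f" using fc by (simp add: field_simps)
    qed
    \<comment> \<open>The parameter 0 puts \<open>q\<close> below \<open>m\<close>, so minimality
      makes them equal; the parameter 1 then gives the missing inequality m f + m g \<le> m (f +
      g).\<close>
    moreover have "q h \<le> m h" if "h \<in> V" for h using q_le[OF that, of 0] by simp
    ultimately have "q f = m f" using min f by blast
    then show ?thesis using q_le[OF f, of 1] sublinear_on_add[OF m(1) f g] by simp
  qed
  have neg: "m (\<lambda>s. - f s) = - m f" if "f \<in> V" for f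
    using add[OF that VI(3)[OF that]] sublinear_on_zero[OF V m(1)] by simp
  have "m (\<lambda>s. c * f s) = c * m f" if f: "f \<in> V" for f c
  proof -
    consider "c > 0" | "c = 0" | "c < 0" by linarith
    then show ?thesis
    proof cases
      case 3
      then have "m (\<lambda>s. (- c) * f s) = (- c) * m f"
        using f by (intro sublinear_on_scale[OF V m(1)]) auto
      then show ?thesis using neg[OF VI(2)[OF f, of c]] by simp
    qed (use sublinear_on_scale[OF V m(1) f] sublinear_on_zero[OF V m(1)] in auto)
  qed
  then show ?thesis using add m(2) by blast
qed

section \<open>Means: integration against finitely additive probabilities on all subsets of a
  set\<close>

definition mean :: "'s set \<Rightarrow> (('s \<Rightarrow> real) \<Rightarrow> real) \<Rightarrow> bool" where
  "mean S L \<longleftrightarrow>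
     (\<forall>f\<in>bdd_funs S. \<forall>g\<in>bdd_funs S. L (\<lambda>s. f s + g s) = L f + L g) \<and>
     (\<forall>f\<in>bdd_funs S. \<forall>c. L (\<lambda>s. c * f s) = c * L f) \<and>
     (\<forall>f\<in>bdd_funs S. (\<forall>s\<in>S. 0 \<le> f s) \<longrightarrow> 0 \<le> L f) \<and> L (\<lambda>_. 1) = 1"

text \<open>Hahn-Banach for the functional that takes \<open>f\<close> to the infimum over g in G of
  sup (f + g). A linear functional below it is below the supremum, hence positive and normalized,
  and it is at most 0 on \<open>G\<close>, since - g is available to cancel g; as \<open>G\<close>
  is symmetric, it vanishes there.\<close>

lemma ex_mean_vanishing:
  assumes G: "fun_subspace G" "G \<subseteq> bdd_funs S"
    and pos: "\<And>g e. g \<in> G \<Longrightarrow> 0 < e \<Longrightarrow> \<exists>s\<in>S. - e \<le> g s"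
  obtains L where "mean S L" "\<And>g. g \<in> G \<Longrightarrow> L g = 0"
proof -
  have G0: "(\<lambda>_. 0) \<in> G" using fun_subspace_zero[OF G(1)] .
  then have S: "S \<noteq> {}" using pos[of "\<lambda>_. 0" 1] by auto
  note Gb = subsetD[OF G(2)]
  define sp where "sp f = (SUP s\<in>S. f s)" for f :: "'a \<Rightarrow> real"
  have sp_ge: "f s \<le> sp f" if f: "f \<in> bdd_funs S" "s \<in> S" for f s
  proof -
    obtain B where "\<And>s. s \<in> S \<Longrightarrow> \<bar>f s\<bar> \<le> B" using bdd_funsE[OF f(1)] by blast
    then have "bdd_above (f ` S)" by (intro bdd_aboveI2[of _ _ B]) (auto simp: abs_le_iff)
    then show ?thesis unfolding sp_def using f(2) by (intro cSUP_upper)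
  qed
  have sp_le: "sp f \<le> x" if "\<And>s. s \<in> S \<Longrightarrow> f s \<le> x" for f x
    unfolding sp_def using S that by (intro cSUP_least)
  define p where "p f = (INF g\<in>G. sp (\<lambda>s. f s + g s))" for f
  have below: "bdd_below ((\<lambda>g. sp (\<lambda>s. f s + g s)) ` G)" if f: "f \<in> bdd_funs S" for f
  proof -
    obtain B where B: "\<And>s. s \<in> S \<Longrightarrow> \<bar>f s\<bar> \<le> B" using bdd_funsE[OF f] by blast
    show ?thesis
    proof (rule bdd_belowI2[of _ "- B - 1"])
      fix g assume g: "g \<in> G"
      \<comment> \<open>The hypothesis on \<open>G\<close> keeps the infimum finite: every g is at
        least -1 somewhere, so it cannot push the supremum below - B - 1.\<close>
      then obtain s where s: "s \<in> S" "- 1 \<le> g s" using pos[of g 1] by auto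
      have "f s + g s \<le> sp (\<lambda>s. f s + g s)" using f Gb[OF g] s(1) by (intro sp_ge) auto
      then show "- B - 1 \<le> sp (\<lambda>s. f s + g s)" using s B[OF s(1)] by (simp add: abs_le_iff)
    qed
  qed
  have p_le: "p f \<le> sp (\<lambda>s. f s + g s)" if "f \<in> bdd_funs S" "g \<in> G" for f g
    unfolding p_def by (rule cINF_lower[OF below[OF that(1)] that(2)])
  have p_ge: "x \<le> p f" if "\<And>g. g \<in> G \<Longrightarrow> x \<le> sp (\<lambda>s. f s + g s)" for x f
    unfolding p_def using G0 by (intro cINF_greatest that) auto
  have "sublinear_on (bdd_funs S) p"
    unfolding sublinear_on_def
  proof (intro conjI ballI allI impI)
    fix f1 f2 assume f: "f1 \<in> bdd_funs S" "f2 \<in> bdd_funs S"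
    have *: "p (\<lambda>s. f1 s + f2 s) \<le> sp (\<lambda>s. f1 s + g1 s) + sp (\<lambda>s. f2 s + g2 s)"
      if g: "g1 \<in> G" "g2 \<in> G" for g1 g2
    proof -
      have "p (\<lambda>s. f1 s + f2 s) \<le> sp (\<lambda>s. (f1 s + f2 s) + (g1 s + g2 s))"
        using f g by (intro p_le fun_subspace_add[OF G(1)]) auto
      also have "\<dots> \<le> sp (\<lambda>s. f1 s + g1 s) + sp (\<lambda>s. f2 s + g2 s)"
      proof (rule sp_le)
        fix s assume "s \<in> S"
        then have "f1 s + g1 s \<le> sp (\<lambda>s. f1 s + g1 s)" "f2 s + g2 s \<le> sp (\<lambda>s. f2 s + g2 s)"
          using f Gb[OF g(1)] Gb[OF g(2)] by (auto intro!: sp_ge[of "\<lambda>s. f1 s + g1 s"] sp_ge[of "\<lambda>s. f2 s + g2 s"])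
        then show "f1 s + f2 s + (g1 s + g2 s) \<le> sp (\<lambda>s. f1 s + g1 s) + sp (\<lambda>s. f2 s + g2 s)" by simp
      qed
      finally show ?thesis .
    qed
    have "p (\<lambda>s. f1 s + f2 s) - p f1 \<le> p f2"
    proof (rule p_ge)
      fix g2 assume g2: "g2 \<in> G"
      have "p (\<lambda>s. f1 s + f2 s) - sp (\<lambda>s. f2 s + g2 s) \<le> p f1"
        by (rule p_ge) (use *[OF _ g2] in \<open>simp add: algebra_simps\<close>)
      then show "p (\<lambda>s. f1 s + f2 s) - p f1 \<le> sp (\<lambda>s. f2 s + g2 s)" by simp
    qed
    then show "p (\<lambda>s. f1 s + f2 s) \<le> p f1 + p f2" by simp
  next
    fix f and c :: real assume f: "f \<in> bdd_funs S" "0 < c"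
    have "p (\<lambda>s. c * f s) / c \<le> p f"
    proof (rule p_ge)
      fix g assume g: "g \<in> G"
      have "p (\<lambda>s. c * f s) \<le> sp (\<lambda>s. c * f s + c * g s)"
        using f g by (intro p_le fun_subspace_scale[OF G(1)]) auto
      also have "\<dots> \<le> c * sp (\<lambda>s. f s + g s)"
      proof (rule sp_le)
        fix s assume "s \<in> S"
        then have "f s + g s \<le> sp (\<lambda>s. f s + g s)" using f Gb[OF g] by (intro sp_ge) auto
        then show "c * f s + c * g s \<le> c * sp (\<lambda>s. f s + g s)"
          using f(2) by (simp flip: distrib_left)
      qed
      finally show "p (\<lambda>s. c * f s) / c \<le> sp (\<lambda>s. f s + g s)" using f by (simp add: field_simps)
    qed
    then show "p (\<lambda>s. c * f s) \<le> c * p f" using f by (simp add: field_simps)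
  qed
  from linear_below_sublinear_on[OF fun_subspace_bdd_funs this]
  obtain L where add: "\<forall>f\<in>bdd_funs S. \<forall>g\<in>bdd_funs S. L (\<lambda>s. f s + g s) = L f + L g"
    and scale: "\<forall>f\<in>bdd_funs S. \<forall>c. L (\<lambda>s. c * f s) = c * L f"
    and le: "\<forall>f\<in>bdd_funs S. L f \<le> p f"
    by blast
  have L_le: "L f \<le> x" if "f \<in> bdd_funs S" "g \<in> G" "\<And>s. s \<in> S \<Longrightarrow> f s + g s \<le> x" for f g x
    using bspec[OF le that(1)] p_le[OF that(1,2)] sp_le[of "\<lambda>s. f s + g s" x] that(3) by fastforce
  have neg: "L (\<lambda>s. - f s) = - L f" if "f \<in> bdd_funs S" for f
    using scale[rule_format, OF that, of "-1"] by simp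
  have zero: "L g = 0" if g: "g \<in> G" for g
  proof -
    have "L g \<le> 0" using g by (intro L_le[OF Gb fun_subspace_minus[OF G(1)]]) auto
    moreover have "L (\<lambda>s. - g s) \<le> 0"
      using g by (intro L_le[OF Gb[OF fun_subspace_minus[OF G(1)]]]) auto
    ultimately show ?thesis using neg[OF Gb[OF g]] by simp
  qed
  have "0 \<le> L f" if f: "f \<in> bdd_funs S" "\<forall>s\<in>S. 0 \<le> f s" for f
    using L_le[OF bdd_funs_minus[OF f(1)] G0, of 0] f neg[OF f(1)] by simp
  moreover have "L (\<lambda>_. 1) = 1"
    using L_le[of "\<lambda>_. 1" "\<lambda>_. 0" 1] L_le[of "\<lambda>_. - 1" "\<lambda>_. 0" "-1"] neg[of "\<lambda>_. 1"] G0 by simp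
  ultimately have "mean S L" using add scale by (simp add: mean_def)
  then show thesis using that zero by blast
qed

context
  fixes S :: "'s set" and L
  assumes L: "mean S L"
begin

lemma mean_add: "f \<in> bdd_funs S \<Longrightarrow> g \<in> bdd_funs S \<Longrightarrow> L (\<lambda>s. f s + g s) = L f + L g"
  and mean_scale: "f \<in> bdd_funs S \<Longrightarrow> L (\<lambda>s. c * f s) = c * L f"
  and mean_nonneg: "f \<in> bdd_funs S \<Longrightarrow> (\<And>s. s \<in> S \<Longrightarrow> 0 \<le> f s) \<Longrightarrow> 0 \<le> L f"
  using L by (auto simp: mean_def)

lemma mean_const: "L (\<lambda>_. c) = c"
  using L mean_scale[of "\<lambda>_. 1" c] by (simp add: mean_def)

lemma mean_diff:
  assumes "f \<in> bdd_funs S" "g \<in> bdd_funs S"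
  shows "L (\<lambda>s. f s - g s) = L f - L g"
  using mean_add[OF assms(1) bdd_funs_scale[OF assms(2), of "-1"]] mean_scale[OF assms(2), of "-1"]
  by simp

lemma mean_mono:
  assumes "f \<in> bdd_funs S" "g \<in> bdd_funs S" "\<And>s. s \<in> S \<Longrightarrow> f s \<le> g s"
  shows "L f \<le> L g"
  using mean_nonneg[OF bdd_funs_diff[OF assms(2,1)]] mean_diff[OF assms(2,1)] assms(3) by simp

lemma mean_cong:
  assumes "f \<in> bdd_funs S" "\<And>s. s \<in> S \<Longrightarrow> f s = g s"
  shows "L f = L g"
proof -
  have "g \<in> bdd_funs S" using assms by (auto simp: bdd_funs_def)
  then show ?thesis using assms mean_mono[of f g] mean_mono[of g f] by simp
qed

lemma mean_abs_le:
  assumes "f \<in> bdd_funs S" "\<And>s. s \<in> S \<Longrightarrow> \<bar>f s\<bar> \<le> c"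
  shows "\<bar>L f\<bar> \<le> c"
  using mean_mono[OF assms(1), of "\<lambda>_. c"] mean_mono[OF _ assms(1), of "\<lambda>_. - c"]
    assms(2) mean_const by (fastforce simp: abs_le_iff)

lemma mean_sum:
  assumes "finite T" "\<And>t. t \<in> T \<Longrightarrow> f t \<in> bdd_funs S"
  shows "(\<lambda>s. \<Sum>t\<in>T. f t s) \<in> bdd_funs S \<and> L (\<lambda>s. \<Sum>t\<in>T. f t s) = (\<Sum>t\<in>T. L (f t))"
  using assms by (induction T) (auto simp: mean_const mean_add)

end

section \<open>Charges and powermeans induced by a mean\<close>

text \<open>The mean lives on a set \<open>S\<close> that projects to \<open>I\<close>; later \<open>S\<close> is the product of the two index
  sets, so that one mean induces both charges.\<close>

locale mean_charge =
  fixes I :: "'i set" and A :: "'i set set" and S :: "'s set" and L :: "('s \<Rightarrow> real) \<Rightarrow> real"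
    and \<pi> :: "'s \<Rightarrow> 'i"
  assumes alg: "algebra I A" and mean: "mean S L" and proj: "\<pi> \<in> S \<rightarrow> I"
begin

text \<open>The image under \<open>\<pi>\<close> of the finitely additive probability that
  \<open>L\<close> defines on \<open>S\<close>.\<close>

definition charge :: "'i set \<Rightarrow> real" where
  "charge X = L (\<lambda>s. of_bool (\<pi> s \<in> X))"

lemma bdd_funs_of_bool [simp]: "(\<lambda>s. of_bool (P s) :: real) \<in> bdd_funs S"
  by (rule bdd_funsI[of _ _ 1]) simp

lemma bdd_funs_proj: "g \<in> bdd_funs I \<Longrightarrow> (\<lambda>s. g (\<pi> s)) \<in> bdd_funs S"
  using proj by (fastforce simp: bdd_funs_def)

lemma charge_space: "charge_space I A charge"
proof -
  have "charge (X \<union> Y) = charge X + charge Y" if "X \<inter> Y = {}" for X Y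
  proof -
    have "(\<lambda>s. of_bool (\<pi> s \<in> X \<union> Y)) = (\<lambda>s. of_bool (\<pi> s \<in> X) + of_bool (\<pi> s \<in> Y) :: real)"
      using that by (auto simp: of_bool_def fun_eq_iff)
    then show ?thesis by (simp add: charge_def mean_add[OF mean])
  qed
  moreover have "0 \<le> charge X" for X
    unfolding charge_def by (rule mean_nonneg[OF mean]) auto
  moreover have "charge I = 1"
    using mean_cong[OF mean, of "\<lambda>_. 1" "\<lambda>s. of_bool (\<pi> s \<in> I)"] proj
    by (auto simp: charge_def mean_const[OF mean])
  ultimately show ?thesis using alg by (simp add: charge_space_def)
qed

lemma simple_int_eq_mean:
  assumes "simple_fun I A g"
  shows "(\<lambda>s. g (\<pi> s)) \<in> bdd_funs S \<and> simple_int I charge g = L (\<lambda>s. g (\<pi> s))"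
proof -
  define h where "h r s = r * of_bool (\<pi> s \<in> {i \<in> I. g i = r})" for r s
  have fin: "finite (g ` I)" using assms by (simp add: simple_fun_def)
  have h: "h r \<in> bdd_funs S" for r unfolding h_def by (intro bdd_funs_scale) simp
  have eq: "(\<Sum>r\<in>g ` I. h r s) = g (\<pi> s)" if "s \<in> S" for s
  proof -
    have "\<pi> s \<in> I" using that proj by auto
    then have "(\<Sum>r\<in>g ` I. h r s) = (\<Sum>r\<in>g ` I. if r = g (\<pi> s) then r else 0)"
      by (intro sum.cong) (auto simp: h_def)
    then show ?thesis using fin \<open>\<pi> s \<in> I\<close> by simp
  qed
  have "simple_int I charge g = (\<Sum>r\<in>g ` I. L (h r))"
    unfolding simple_int_def charge_def h_def by (subst mean_scale[OF mean]) auto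
  also have "\<dots> = L (\<lambda>s. \<Sum>r\<in>g ` I. h r s)"
    using mean_sum[OF mean fin, of h] h by simp
  also have "\<dots> = L (\<lambda>s. g (\<pi> s))"
    using mean_sum[OF mean fin, of h] h eq by (intro mean_cong[OF mean]) auto
  finally show ?thesis
    using mean_sum[OF mean fin, of h] h eq by (auto simp: bdd_funs_def)
qed

text \<open>Both sides agree on simple functions, and a mean moves by at most the uniform distance
  of its arguments.\<close>

lemma charge_int_eq_mean:
  assumes g: "g \<in> bdd_funs I" and meas: "\<And>P. {i \<in> I. P (g i)} \<in> A"
  shows "charge_int I A charge g = L (\<lambda>s. g (\<pi> s))"
proof (rule charge_int_eqI[OF charge_space])
  \<comment> \<open>\<open>g\<close> rounded down to multiples of 1/(n+1): finitely many values
    because \<open>g\<close> is bounded, and uniformly within 1/(n+1) of \<open>g\<close>.\<close>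
  define s where "s n i = of_int \<lfloor>g i * real (Suc n)\<rfloor> / real (Suc n)" for n i
  have close: "\<bar>s n i - g i\<bar> \<le> 1 / real (Suc n)" for n i
  proof -
    have "\<bar>of_int \<lfloor>g i * real (Suc n)\<rfloor> - g i * real (Suc n)\<bar> \<le> 1" by linarith
    then have "\<bar>of_int \<lfloor>g i * real (Suc n)\<rfloor> - g i * real (Suc n)\<bar> / real (Suc n) \<le> 1 / real (Suc n)"
      by (intro divide_right_mono) auto
    moreover have "s n i - g i = (of_int \<lfloor>g i * real (Suc n)\<rfloor> - g i * real (Suc n)) / real (Suc n)"
      by (simp add: s_def field_simps del: of_nat_Suc)
    ultimately show ?thesis by (simp add: abs_divide del: of_nat_Suc)
  qed
  have simple: "simple_fun I A (s n)" for n
  proof -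
    obtain B where B: "\<And>i. i \<in> I \<Longrightarrow> \<bar>g i\<bar> \<le> B" using bdd_funsE[OF g] by blast
    have "\<lfloor>g i * real (Suc n)\<rfloor> \<in> {\<lfloor>- B * real (Suc n)\<rfloor>..\<lfloor>B * real (Suc n)\<rfloor>}" if "i \<in> I" for i
    proof -
      have "- B \<le> g i" "g i \<le> B" using B[OF that] by (auto simp: abs_le_iff)
      then show ?thesis unfolding atLeastAtMost_iff by (intro conjI floor_mono mult_right_mono) auto
    qed
    then have "s n ` I \<subseteq> (\<lambda>k. of_int k / real (Suc n)) ` {\<lfloor>- B * real (Suc n)\<rfloor>..\<lfloor>B * real (Suc n)\<rfloor>}"
      unfolding s_def by blast
    then have "finite (s n ` I)" by (rule finite_subset) auto
    moreover have "{i \<in> I. s n i = r} \<in> A" for r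
      unfolding s_def by (rule meas[of "\<lambda>x. of_int \<lfloor>x * real (Suc n)\<rfloor> / real (Suc n) = r"])
    ultimately show ?thesis by (simp add: simple_fun_def)
  qed
  have lim0: "(\<lambda>n. 1 / real (Suc n)) \<longlonglongrightarrow> 0" by (rule LIMSEQ_Suc[OF lim_1_over_n])
  have "uniform_limit I s g sequentially"
    unfolding uniform_limit_iff
  proof (intro allI impI)
    fix e :: real assume "0 < e"
    then have "\<forall>\<^sub>F n in sequentially. 1 / real (Suc n) < e"
      using order_tendstoD(2)[OF lim0] by blast
    then show "\<forall>\<^sub>F n in sequentially. \<forall>i\<in>I. dist (s n i) (g i) < e"
      by eventually_elim (use close in \<open>auto simp: dist_real_def simp del: of_nat_Suc intro: le_less_trans\<close>)
  qed
  moreover have "(\<lambda>n. simple_int I charge (s n)) \<longlonglongrightarrow> L (\<lambda>s. g (\<pi> s))"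
  proof (rule metric_tendsto_imp_tendsto[OF lim0], rule always_eventually, rule allI)
    fix n
    have "L (\<lambda>t. s n (\<pi> t)) - L (\<lambda>t. g (\<pi> t)) = L (\<lambda>t. s n (\<pi> t) - g (\<pi> t))"
      using simple_int_eq_mean[OF simple] bdd_funs_proj[OF g] by (simp add: mean_diff[OF mean])
    moreover have "\<bar>L (\<lambda>t. s n (\<pi> t) - g (\<pi> t))\<bar> \<le> 1 / real (Suc n)"
      using simple_int_eq_mean[OF simple] bdd_funs_proj[OF g] close
      by (intro mean_abs_le[OF mean] bdd_funs_diff) auto
    ultimately show "dist (simple_int I charge (s n)) (L (\<lambda>s. g (\<pi> s))) \<le> dist (1 / real (Suc n)) 0"
      using simple_int_eq_mean[OF simple[of n]] by (simp add: dist_real_def del: of_nat_Suc)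
  qed
  ultimately show "has_charge_int I A charge g (L (\<lambda>s. g (\<pi> s)))"
    unfolding has_charge_int_def using simple by blast
qed

end

text \<open>Transfers vanishing distance to functions and relations of the signature. A modulus is
  below e near 0, and elsewhere its values on the bounded range of \<open>u\<close> are at most a
  multiple of \<open>u\<close>; so w is bounded by e plus a multiple of \<open>u\<close>, whose mean
  is e.\<close>

lemma mean_modulus_eq_0:
  assumes L: "mean S L" and l: "modulus l" and u: "u \<in> bdd_funs S" "\<And>s. s \<in> S \<Longrightarrow> 0 \<le> u s" "L u = 0"
    and w: "w \<in> bdd_funs S" "\<And>s. s \<in> S \<Longrightarrow> \<bar>w s\<bar> \<le> l (u s)"
  shows "L w = 0"
proof -
  obtain B where B: "0 \<le> B" "\<And>s. s \<in> S \<Longrightarrow> \<bar>u s\<bar> \<le> B" using bdd_funsE[OF u(1)] by blast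
  have mono: "l x \<le> l y" if "0 \<le> x" "x \<le> y" for x y
    using l that by (auto simp: modulus_def monotone_on_def)
  have lB: "0 \<le> l B" using l B(1) by (auto simp: modulus_def)
  have "\<bar>L w\<bar> \<le> e" if e: "0 < e" for e
  proof -
    have "continuous (at 0 within {0..}) l" "l 0 = 0"
      using l by (auto simp: modulus_def continuous_on_eq_continuous_within)
    then obtain d where d: "0 < d" "\<And>x. 0 \<le> x \<Longrightarrow> x < d \<Longrightarrow> \<bar>l x\<bar> < e"
      using e unfolding continuous_within_eps_delta by (auto simp: dist_real_def)
    \<comment> \<open>Below \<open>d\<close> the first summand suffices by continuity at 0. From
      \<open>d\<close> on, u s / d is at least 1 and l (u s) is at most l B by monotonicity.\<close>
    have le: "\<bar>w s\<bar> \<le> e + (l B / d) * u s" if s: "s \<in> S" for s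
    proof (cases "u s < d")
      case True
      then have "l (u s) \<le> e" using d(2)[of "u s"] u(2)[OF s] by simp
      moreover have "0 \<le> (l B / d) * u s" using lB d(1) u(2)[OF s] by simp
      ultimately show ?thesis using w(2)[OF s] by linarith
    next
      case False
      then have "l B * 1 \<le> l B * (u s / d)" using lB d(1) by (intro mult_left_mono) auto
      moreover have "l (u s) \<le> l B" using B(2)[OF s] u(2)[OF s] by (intro mono) auto
      ultimately show ?thesis using w(2)[OF s] e by simp
    qed
    have b: "(\<lambda>s. e + (l B / d) * u s) \<in> bdd_funs S"
      by (intro bdd_funs_add bdd_funs_const bdd_funs_scale u(1))
    have v: "L (\<lambda>s. e + (l B / d) * u s) = e"
      using u by (simp add: mean_add[OF L] mean_scale[OF L] mean_const[OF L] bdd_funs_scale del: times_divide_eq_left)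
    have "L w \<le> e" using mean_mono[OF L w(1) b] le v by (fastforce simp: abs_le_iff)
    moreover have "L (\<lambda>s. - w s) \<le> e"
      using mean_mono[OF L bdd_funs_minus[OF w(1)] b] le v by (fastforce simp: abs_le_iff)
    moreover have "L (\<lambda>s. - w s) = - L w" using mean_scale[OF L w(1), of "-1"] by simp
    ultimately show ?thesis by linarith
  qed
  then show ?thesis using field_le_epsilon[of "\<bar>L w\<bar>" 0] by simp
qed

lemma is_structureD:
  assumes "is_structure \<tau> M"
  shows "carr M \<noteq> {}" "Metric_space (carr M) (sdist \<tau> M)"
    "c \<in> csyms \<tau> \<Longrightarrow> cint M c \<in> carr M"
    "F \<in> fsyms \<tau> \<Longrightarrow> xs \<in> tuples M (farity \<tau> F) \<Longrightarrow> fint M F xs \<in> carr M"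
    "F \<in> fsyms \<tau> \<Longrightarrow> xs \<in> tuples M (farity \<tau> F) \<Longrightarrow> ys \<in> tuples M (farity \<tau> F) \<Longrightarrow>
      sdist \<tau> M (fint M F xs) (fint M F ys) \<le> fmod \<tau> F (tdist \<tau> M xs ys)"
    "R \<in> rsyms \<tau> \<Longrightarrow> xs \<in> tuples M (rarity \<tau> R) \<Longrightarrow> \<bar>rint M R xs\<bar> \<le> rbound \<tau> R"
    "R \<in> rsyms \<tau> \<Longrightarrow> xs \<in> tuples M (rarity \<tau> R) \<Longrightarrow> ys \<in> tuples M (rarity \<tau> R) \<Longrightarrow>
      \<bar>rint M R xs - rint M R ys\<bar> \<le> rmod \<tau> R (tdist \<tau> M xs ys)"
  using assms unfolding is_structure_def by auto

lemma sdist_bounds: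
  assumes "is_signature \<tau>" "is_structure \<tau> M"
  shows "0 \<le> sdist \<tau> M x y" "sdist \<tau> M x y \<le> 1"
proof -
  show "0 \<le> sdist \<tau> M x y" using is_structureD(2)[OF assms(2)] by (simp add: Metric_space.nonneg)
  have "sdist \<tau> M x y \<le> 1" if "x \<in> carr M" "y \<in> carr M"
    using is_structureD(6)[OF assms(2), of "dsym \<tau>" "[x, y]"] assms(1) that
    by (simp add: is_signature_def tuples_def sdist_def)
  then show "sdist \<tau> M x y \<le> 1" by (cases "x \<in> carr M \<and> y \<in> carr M") (auto simp: sdist_def)
qed

text \<open>The assumption \<open>discr\<close> says that finitely many measurable maps are jointly measurable for
  the discrete structure on the points.\<close>

locale mean_powermean = mean_charge I A S L \<pi>
  for I :: "'i set" and A :: "'i set set" and S :: "'s set" and L :: "('s \<Rightarrow> real) \<Rightarrow> real"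
    and \<pi> :: "'s \<Rightarrow> 'i" +
  fixes \<tau> :: "('f, 'r, 'c) lsig" and M :: "('a, 'f, 'r, 'c) struct"
  assumes sig: "is_signature \<tau>" and str: "is_structure \<tau> M"
    and discr: "\<And>as P. set as \<subseteq> mmaps \<tau> M I A \<Longrightarrow> {i \<in> I. P (map (\<lambda>a. a i) as)} \<in> A"
begin

abbreviation "maps \<equiv> mmaps \<tau> M I A"
abbreviation "dM \<equiv> sdist \<tau> M"
abbreviation "P \<equiv> powermean \<tau> M I A charge"

definition mdist :: "('i \<Rightarrow> 'a) \<Rightarrow> ('i \<Rightarrow> 'a) \<Rightarrow> real" where
  "mdist a b = L (\<lambda>s. dM (a (\<pi> s)) (b (\<pi> s)))"

definition cls :: "('i \<Rightarrow> 'a) \<Rightarrow> ('i \<Rightarrow> 'a) set" where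
  "cls a = mrel \<tau> M I A charge `` {a}"

definition fmap :: "'f \<Rightarrow> ('i \<Rightarrow> 'a) list \<Rightarrow> 'i \<Rightarrow> 'a" where
  "fmap F as = (\<lambda>i\<in>I. fint M F (map (\<lambda>a. a i) as))"

lemma metric: "Metric_space (carr M) dM"
  using is_structureD(2)[OF str] .

lemma mmaps_carr: "a \<in> maps \<Longrightarrow> i \<in> I \<Longrightarrow> a i \<in> carr M"
  by (auto simp: mmaps_def)

lemma proj_in: "s \<in> S \<Longrightarrow> \<pi> s \<in> I"
  using proj by auto

lemma tuples_maps: "set as \<subseteq> maps \<Longrightarrow> i \<in> I \<Longrightarrow> map (\<lambda>a. a i) as \<in> tuples M (length as)"
  using mmaps_carr by (auto simp: tuples_def)

lemma mmapsI: "a \<in> I \<rightarrow>\<^sub>E carr M \<Longrightarrow> (\<And>X. {i \<in> I. a i \<in> X} \<in> A) \<Longrightarrow> a \<in> maps"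
  by (simp add: mmaps_def)

lemma bdd_dist: "(\<lambda>s. dM (u s) (v s)) \<in> bdd_funs T"
  using sdist_bounds[OF sig str] by (intro bdd_funsI[of _ _ 1]) (simp add: abs_le_iff order_trans[of _ 0])

lemma mdist_nonneg: "0 \<le> mdist a b"
  unfolding mdist_def using sdist_bounds[OF sig str] bdd_dist by (intro mean_nonneg[OF mean])

lemma mdist_refl: "a \<in> maps \<Longrightarrow> mdist a a = 0"
  using mean_cong[OF mean, of "\<lambda>_. 0" "\<lambda>s. dM (a (\<pi> s)) (a (\<pi> s))"]
    Metric_space.mdist_zero[OF metric] mmaps_carr proj_in
  by (simp add: mdist_def mean_const[OF mean])

lemma mdist_commute: "mdist a b = mdist b a"
  unfolding mdist_def by (rule arg_cong[of _ _ L]) (rule ext, rule Metric_space.commute[OF metric])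

lemma mdist_triangle:
  assumes "a \<in> maps" "b \<in> maps" "c \<in> maps"
  shows "mdist a c \<le> mdist a b + mdist b c"
  unfolding mdist_def using assms mmaps_carr proj_in
  by (subst mean_add[OF mean, symmetric])
    (auto intro!: mean_mono[OF mean] bdd_dist bdd_funs_add Metric_space.triangle[OF metric])

lemma charge_int_dist:
  assumes "a \<in> maps" "b \<in> maps"
  shows "charge_int I A charge (\<lambda>i. dM (a i) (b i)) = mdist a b"
  unfolding mdist_def
  by (rule charge_int_eq_mean[OF bdd_dist])
    (use discr[of "[a, b]" "\<lambda>xs. Q (dM (xs ! 0) (xs ! 1))" for Q] assms in simp)

lemma mrel_iff: "(a, b) \<in> mrel \<tau> M I A charge \<longleftrightarrow> a \<in> maps \<and> b \<in> maps \<and> mdist a b = 0"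
  using charge_int_dist by (auto simp: mrel_def)

lemma equiv_mrel: "equiv maps (mrel \<tau> M I A charge)"
proof (rule equivI)
  show "mrel \<tau> M I A charge \<subseteq> maps \<times> maps" by (auto simp: mrel_def)
  show "refl_on maps (mrel \<tau> M I A charge)"
    by (auto simp: refl_on_def mrel_iff mdist_refl)
  show "sym (mrel \<tau> M I A charge)" by (auto simp: sym_def mrel_iff mdist_commute)
  show "trans (mrel \<tau> M I A charge)"
  proof (rule transI)
    fix a b c assume "(a, b) \<in> mrel \<tau> M I A charge" "(b, c) \<in> mrel \<tau> M I A charge"
    then show "(a, c) \<in> mrel \<tau> M I A charge"
      using mdist_triangle[of a b c] mdist_nonneg[of a c] by (auto simp: mrel_iff)
  qed
qed

lemma cls_eq_iff: "a \<in> maps \<Longrightarrow> b \<in> maps \<Longrightarrow> cls a = cls b \<longleftrightarrow> mdist a b = 0"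
  unfolding cls_def using eq_equiv_class_iff[OF equiv_mrel] by (simp add: mrel_iff)

lemma carr_powermean: "carr P = cls ` maps"
  by (auto simp: powermean_def quotient_def cls_def)

lemma crep_cls: 
  assumes "a \<in> maps"
  shows "crep (cls a) \<in> maps" "mdist (crep (cls a)) a = 0"
proof -
  have "a \<in> cls a" using assms by (simp add: cls_def mrel_iff mdist_refl)
  then have "crep (cls a) \<in> cls a" unfolding crep_def by (rule someI[of "\<lambda>b. b \<in> cls a"])
  then show "crep (cls a) \<in> maps" "mdist (crep (cls a)) a = 0"
    by (auto simp: cls_def mrel_iff mdist_commute)
qed

lemma mean_tdist_eq_0:
  assumes "length as = length bs" "\<And>k. k < length as \<Longrightarrow> mdist (as ! k) (bs ! k) = 0"
  shows "(\<lambda>s. tdist \<tau> M (map (\<lambda>a. a (\<pi> s)) as) (map (\<lambda>a. a (\<pi> s)) bs)) \<in> bdd_funs S \<and>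
    L (\<lambda>s. tdist \<tau> M (map (\<lambda>a. a (\<pi> s)) as) (map (\<lambda>a. a (\<pi> s)) bs)) = 0"
proof -
  have "(\<lambda>s. tdist \<tau> M (map (\<lambda>a. a (\<pi> s)) as) (map (\<lambda>a. a (\<pi> s)) bs)) =
      (\<lambda>s. \<Sum>k<length as. dM ((as ! k) (\<pi> s)) ((bs ! k) (\<pi> s)))"
    using assms(1) by (simp add: tdist_def fun_eq_iff)
  then show ?thesis
    using mean_sum[OF mean, of "{..<length as}" "\<lambda>k s. dM ((as ! k) (\<pi> s)) ((bs ! k) (\<pi> s))",
        OF finite_lessThan bdd_dist] assms(2)
    by (simp add: mdist_def)
qed

lemma tdist_nonneg: "0 \<le> tdist \<tau> M xs ys"
  unfolding tdist_def using sdist_bounds[OF sig str] by (intro sum_nonneg)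

lemma bdd_rel:
  assumes "R \<in> rsyms \<tau>" "set as \<subseteq> maps" "length as = rarity \<tau> R"
  shows "(\<lambda>i. rint M R (map (\<lambda>a. a i) as)) \<in> bdd_funs I"
  using is_structureD(6)[OF str assms(1)] tuples_maps[OF assms(2)] assms(3)
  by (intro bdd_funsI[of _ _ "rbound \<tau> R"]) auto

text \<open>Values in the powermean are computed on chosen representatives; this makes the choice
  immaterial. The difference is bounded by the modulus at the distance of the two tuples, which has
  mean 0.\<close>

lemma mean_rel_cong:
  assumes R: "R \<in> rsyms \<tau>" and as: "set as \<subseteq> maps" "length as = rarity \<tau> R"
    and bs: "set bs \<subseteq> maps" "length bs = rarity \<tau> R"
    and eq: "\<And>k. k < length as \<Longrightarrow> mdist (as ! k) (bs ! k) = 0"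
  shows "L (\<lambda>s. rint M R (map (\<lambda>a. a (\<pi> s)) as)) = L (\<lambda>s. rint M R (map (\<lambda>a. a (\<pi> s)) bs))"
proof -
  note b = bdd_funs_proj[OF bdd_rel[OF R as]] bdd_funs_proj[OF bdd_rel[OF R bs]]
  have "L (\<lambda>s. rint M R (map (\<lambda>a. a (\<pi> s)) as) - rint M R (map (\<lambda>a. a (\<pi> s)) bs)) = 0"
  proof (rule mean_modulus_eq_0[OF mean])
    show "modulus (rmod \<tau> R)" using sig R by (simp add: is_signature_def)
    show "\<bar>rint M R (map (\<lambda>a. a (\<pi> s)) as) - rint M R (map (\<lambda>a. a (\<pi> s)) bs)\<bar>
        \<le> rmod \<tau> R (tdist \<tau> M (map (\<lambda>a. a (\<pi> s)) as) (map (\<lambda>a. a (\<pi> s)) bs))" if "s \<in> S" for s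
      using tuples_maps[OF as(1)] tuples_maps[OF bs(1)] as(2) bs(2) proj_in[OF that]
      by (intro is_structureD(7)[OF str R]) auto
  qed (use mean_tdist_eq_0[OF _ eq] as bs b tdist_nonneg in \<open>auto intro: bdd_funs_diff\<close>)
  then show ?thesis using mean_diff[OF mean b] by simp
qed

lemma fmap_in:
  assumes F: "F \<in> fsyms \<tau>" and as: "set as \<subseteq> maps" "length as = farity \<tau> F"
  shows "fmap F as \<in> maps"
proof (rule mmapsI)
  show "fmap F as \<in> I \<rightarrow>\<^sub>E carr M"
    using is_structureD(4)[OF str F] tuples_maps[OF as(1)] as(2) by (auto simp: fmap_def)
  fix X
  have "{i \<in> I. fmap F as i \<in> X} = {i \<in> I. fint M F (map (\<lambda>a. a i) as) \<in> X}"
    by (auto simp: fmap_def)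
  then show "{i \<in> I. fmap F as i \<in> X} \<in> A" using discr[OF as(1), of "\<lambda>xs. fint M F xs \<in> X"] by simp
qed

lemma mdist_fmap:
  assumes F: "F \<in> fsyms \<tau>" and as: "set as \<subseteq> maps" "length as = farity \<tau> F"
    and bs: "set bs \<subseteq> maps" "length bs = farity \<tau> F"
    and eq: "\<And>k. k < length as \<Longrightarrow> mdist (as ! k) (bs ! k) = 0"
  shows "mdist (fmap F as) (fmap F bs) = 0"
  unfolding mdist_def
proof (rule mean_modulus_eq_0[OF mean])
  show "modulus (fmod \<tau> F)" using sig F by (simp add: is_signature_def)
  show "\<bar>dM (fmap F as (\<pi> s)) (fmap F bs (\<pi> s))\<bar>
        \<le> fmod \<tau> F (tdist \<tau> M (map (\<lambda>a. a (\<pi> s)) as) (map (\<lambda>a. a (\<pi> s)) bs))" if "s \<in> S" for s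
    using tuples_maps[OF as(1)] tuples_maps[OF bs(1)] as(2) bs(2) proj_in[OF that]
      sdist_bounds[OF sig str] is_structureD(5)[OF str F]
    by (auto simp: fmap_def)
qed (use mean_tdist_eq_0[OF _ eq] as bs bdd_dist tdist_nonneg in auto)

lemma rint_powermean:
  assumes R: "R \<in> rsyms \<tau>" and as: "set as \<subseteq> maps" "length as = rarity \<tau> R"
  shows "rint P R (map cls as) = L (\<lambda>s. rint M R (map (\<lambda>a. a (\<pi> s)) as))"
proof -
  define bs where "bs = map (\<lambda>a. crep (cls a)) as"
  have bs: "set bs \<subseteq> maps" "length bs = rarity \<tau> R" using as crep_cls by (auto simp: bs_def)
  have "rint P R (map cls as) = charge_int I A charge (\<lambda>i. rint M R (map (\<lambda>b. b i) bs))"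
    by (simp add: powermean_def bs_def comp_def)
  also have "\<dots> = L (\<lambda>s. rint M R (map (\<lambda>b. b (\<pi> s)) bs))"
    by (rule charge_int_eq_mean[OF bdd_rel[OF R bs]]) (rule discr[OF bs(1)])
  also have "\<dots> = L (\<lambda>s. rint M R (map (\<lambda>a. a (\<pi> s)) as))"
    using as crep_cls(2) by (intro mean_rel_cong[OF R bs as]) (simp add: bs_def subset_iff)
  finally show ?thesis .
qed

lemma fint_powermean:
  assumes F: "F \<in> fsyms \<tau>" and as: "set as \<subseteq> maps" "length as = farity \<tau> F"
  shows "fint P F (map cls as) = cls (fmap F as)"
proof -
  define bs where "bs = map (\<lambda>a. crep (cls a)) as"
  have bs: "set bs \<subseteq> maps" "length bs = farity \<tau> F" using as crep_cls by (auto simp: bs_def)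
  have "fint P F (map cls as) = cls (fmap F bs)"
    by (simp add: powermean_def bs_def comp_def cls_def fmap_def)
  also have "\<dots> = cls (fmap F as)"
    using as crep_cls(2) mdist_fmap[OF F bs as]
    by (subst cls_eq_iff[OF fmap_in[OF F bs] fmap_in[OF F as]]) (simp add: bs_def subset_iff)
  finally show ?thesis .
qed

lemma const_in: "c \<in> csyms \<tau> \<Longrightarrow> (\<lambda>i\<in>I. cint M c) \<in> maps"
proof (rule mmapsI)
  fix X
  have "{i \<in> I. (\<lambda>i\<in>I. cint M c) i \<in> X} = {i \<in> I. cint M c \<in> X}" by auto
  then show "{i \<in> I. (\<lambda>i\<in>I. cint M c) i \<in> X} \<in> A" using discr[of "[]" "\<lambda>_. cint M c \<in> X"] by simp
qed (use is_structureD(3)[OF str] in auto)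

lemma cint_powermean: "cint P c = cls (\<lambda>i\<in>I. cint M c)"
  by (simp add: powermean_def cls_def)

end

section \<open>Isomorphism of two powermeans over the same mean\<close>

text \<open>Both carriers are enumerated, up to distance 0, by the same set of names. Agreement of
  the atomic formulas in mean then makes the passage from the class of \<open>X z\<close> to the
  class of \<open>Y z\<close> well defined, injective and compatible with all symbols.\<close>

locale two_powermeans =
  M: mean_powermean I A S L \<pi> \<tau> M + N: mean_powermean J B S L \<rho> \<tau> N
  for I :: "'i set" and A :: "'i set set" and J :: "'j set" and B :: "'j set set"
    and S :: "'s set" and L :: "('s \<Rightarrow> real) \<Rightarrow> real" and \<pi> :: "'s \<Rightarrow> 'i" and \<rho> :: "'s \<Rightarrow> 'j"
    and \<tau> :: "('f, 'r, 'c) lsig" and M :: "('a, 'f, 'r, 'c) struct" and N :: "('b, 'f, 'r, 'c) struct" +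
  fixes X :: "'z \<Rightarrow> 'i \<Rightarrow> 'a" and Y :: "'z \<Rightarrow> 'j \<Rightarrow> 'b"
  assumes X_in: "X z \<in> M.maps" and Y_in: "Y z \<in> N.maps"
    and X_onto: "a \<in> M.maps \<Longrightarrow> \<exists>z. M.mdist (X z) a = 0"
    and Y_onto: "b \<in> N.maps \<Longrightarrow> \<exists>z. N.mdist (Y z) b = 0"
    and agree: "fm_ok \<tau> (Rel R ts) \<Longrightarrow>
      L (\<lambda>s. rint M R (map (tm_val M (\<lambda>n. X (\<sigma> n) (\<pi> s))) ts)) =
      L (\<lambda>s. rint N R (map (tm_val N (\<lambda>n. Y (\<sigma> n) (\<rho> s))) ts))"

context mean_powermean
begin

lemma mdist_eq_rint:
  assumes "a \<in> maps" "b \<in> maps"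
  shows "mdist a b = L (\<lambda>s. rint M (dsym \<tau>) [a (\<pi> s), b (\<pi> s)])"
  unfolding mdist_def
  by (rule mean_cong[OF mean bdd_dist]) (use assms mmaps_carr proj_in in \<open>simp add: sdist_def\<close>)

text \<open>Exhibits the distance to a value of \<open>F\<close> as the mean of an atomic formula
  d(x, F(ys)), to which \<open>agree\<close> applies.\<close>

lemma mdist_fmap_eq_rint:
  assumes "a \<in> maps" "F \<in> fsyms \<tau>" "set as \<subseteq> maps" "length as = farity \<tau> F"
  shows "mdist a (fmap F as) = L (\<lambda>s. rint M (dsym \<tau>) [a (\<pi> s), fint M F (map (\<lambda>b. b (\<pi> s)) as)])"
  unfolding mdist_def
proof (rule mean_cong[OF mean bdd_dist])
  fix s assume s: "s \<in> S"
  then show "dM (a (\<pi> s)) (fmap F as (\<pi> s)) = rint M (dsym \<tau>) [a (\<pi> s), fint M F (map (\<lambda>b. b (\<pi> s)) as)]"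
    using proj_in[OF s] mmaps_carr[OF assms(1)] mmaps_carr[OF fmap_in[OF assms(2-4)], of "\<pi> s"]
    by (simp add: sdist_def fmap_def)
qed

lemma mdist_const_eq_rint:
  assumes "a \<in> maps" "c \<in> csyms \<tau>"
  shows "mdist a (\<lambda>i\<in>I. cint M c) = L (\<lambda>s. rint M (dsym \<tau>) [a (\<pi> s), cint M c])"
  unfolding mdist_def
proof (rule mean_cong[OF mean bdd_dist])
  fix s assume s: "s \<in> S"
  then show "dM (a (\<pi> s)) ((\<lambda>i\<in>I. cint M c) (\<pi> s)) = rint M (dsym \<tau>) [a (\<pi> s), cint M c]"
    using proj_in[OF s] mmaps_carr[OF assms(1)] is_structureD(3)[OF str assms(2)]
    by (simp add: sdist_def)
qed

lemma dsym_ok: "dsym \<tau> \<in> rsyms \<tau>" "rarity \<tau> (dsym \<tau>) = 2"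
  using sig by (auto simp: is_signature_def)

end

context two_powermeans
begin

text \<open>Any name of the class will do, by \<open>cls_agree\<close>.\<close>

definition iso :: "('i \<Rightarrow> 'a) set \<Rightarrow> ('j \<Rightarrow> 'b) set" where
  "iso C = N.cls (Y (SOME z. M.cls (X z) = C))"

lemma mdist_agree: "M.mdist (X z) (X w) = N.mdist (Y z) (Y w)"
  using agree[of "dsym \<tau>" "[Var 0, Var 1]" "\<lambda>n. if n = 0 then z else w"] M.dsym_ok X_in Y_in
  by (simp add: M.mdist_eq_rint N.mdist_eq_rint)

lemma mdist_fmap_agree:
  assumes F: "F \<in> fsyms \<tau>" "length zs = farity \<tau> F"
  shows "M.mdist (X w) (M.fmap F (map X zs)) = N.mdist (Y w) (N.fmap F (map Y zs))"
proof -
  \<comment> \<open>Variable 0 stands for \<open>w\<close> and the variables from 1 on for the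
    entries of \<open>zs\<close>, so the assignment is the list \<open>w # zs\<close>.\<close>
  let ?ts = "[Var 0, App F (map Var [1..<Suc (farity \<tau> F)])] :: ('f, 'c) ltm list"
  have eq: "map (tm_val K (\<lambda>n. e ((w # zs) ! n))) ?ts = [e w, fint K F (map e zs)]"
    for K :: "('x, 'f, 'r, 'c) struct" and e
  proof -
    have "map (tm_val K (\<lambda>n. e ((w # zs) ! n))) (map Var [1..<Suc (farity \<tau> F)]) = map e zs"
      using F(2) by (intro nth_equalityI) (simp_all del: upt_Suc)
    then show ?thesis by (simp del: upt_Suc)
  qed
  have "fm_ok \<tau> (Rel (dsym \<tau>) ?ts)" using F M.dsym_ok by simp
  from agree[OF this, of "\<lambda>n. (w # zs) ! n"]
  have "L (\<lambda>s. rint M (dsym \<tau>) [X w (\<pi> s), fint M F (map (\<lambda>z. X z (\<pi> s)) zs)]) =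
      L (\<lambda>s. rint N (dsym \<tau>) [Y w (\<rho> s), fint N F (map (\<lambda>z. Y z (\<rho> s)) zs)])"
    using eq[of M "\<lambda>z. X z (\<pi> s)" for s] eq[of N "\<lambda>z. Y z (\<rho> s)" for s] by (simp only:)
  then show ?thesis
    using M.mdist_fmap_eq_rint[OF X_in F(1), of "map X zs" w] X_in F(2)
      N.mdist_fmap_eq_rint[OF Y_in F(1), of "map Y zs" w] Y_in
    by (simp add: comp_def image_subset_iff)
qed

lemma mdist_const_agree:
  assumes "c \<in> csyms \<tau>"
  shows "M.mdist (X w) (\<lambda>i\<in>I. cint M c) = N.mdist (Y w) (\<lambda>i\<in>J. cint N c)"
  using agree[of "dsym \<tau>" "[Var 0, Const c]" "\<lambda>_. w"] M.dsym_ok X_in Y_in assms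
  by (simp add: M.mdist_const_eq_rint N.mdist_const_eq_rint)

lemma rint_agree:
  assumes "R \<in> rsyms \<tau>" "length zs = rarity \<tau> R"
  shows "rint M.P R (map (\<lambda>z. M.cls (X z)) zs) = rint N.P R (map (\<lambda>z. N.cls (Y z)) zs)"
proof -
  let ?ts = "map Var [0..<rarity \<tau> R] :: ('f, 'c) ltm list"
  have eq: "map (tm_val K (\<lambda>n. e (zs ! n))) ?ts = map e zs" for K :: "('x, 'f, 'r, 'c) struct" and e
    using assms(2) by (intro nth_equalityI) simp_all
  have "fm_ok \<tau> (Rel R ?ts)" using assms by simp
  from agree[OF this, of "\<lambda>n. zs ! n"]
  have "L (\<lambda>s. rint M R (map (\<lambda>z. X z (\<pi> s)) zs)) = L (\<lambda>s. rint N R (map (\<lambda>z. Y z (\<rho> s)) zs))"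
    using eq[of M "\<lambda>z. X z (\<pi> s)" for s] eq[of N "\<lambda>z. Y z (\<rho> s)" for s] by (simp only:)
  then show ?thesis
    using M.rint_powermean[OF assms(1), of "map X zs"] N.rint_powermean[OF assms(1), of "map Y zs"]
      X_in Y_in assms(2)
    by (simp add: comp_def image_subset_iff)
qed

lemma cls_agree: "M.cls (X z) = M.cls (X w) \<longleftrightarrow> N.cls (Y z) = N.cls (Y w)"
  using M.cls_eq_iff[OF X_in X_in] N.cls_eq_iff[OF Y_in Y_in] mdist_agree by simp

lemma iso_cls: "iso (M.cls (X z)) = N.cls (Y z)"
proof -
  have "M.cls (X (SOME w. M.cls (X w) = M.cls (X z))) = M.cls (X z)"
    by (rule someI[of "\<lambda>w. M.cls (X w) = M.cls (X z)"]) simp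
  then show ?thesis unfolding iso_def using cls_agree by blast
qed

lemma ex_cls_X: "a \<in> M.maps \<Longrightarrow> \<exists>z. M.cls (X z) = M.cls a"
  using X_onto M.cls_eq_iff[OF X_in] by metis

lemma ex_cls_Y: "b \<in> N.maps \<Longrightarrow> \<exists>z. N.cls (Y z) = N.cls b"
  using Y_onto N.cls_eq_iff[OF Y_in] by metis

lemma carr_X: "carr M.P = range (\<lambda>z. M.cls (X z))"
proof
  show "carr M.P \<subseteq> range (\<lambda>z. M.cls (X z))"
    unfolding M.carr_powermean using ex_cls_X by (metis image_subsetI rangeI)
qed (use X_in M.carr_powermean in auto)

lemma carr_Y: "carr N.P = range (\<lambda>z. N.cls (Y z))"
proof
  show "carr N.P \<subseteq> range (\<lambda>z. N.cls (Y z))"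
    unfolding N.carr_powermean using ex_cls_Y by (metis image_subsetI rangeI)
qed (use Y_in N.carr_powermean in auto)

lemma tuples_X:
  assumes "Xs \<in> tuples M.P n"
  obtains zs where "length zs = n" "Xs = map (\<lambda>z. M.cls (X z)) zs"
proof -
  have "Xs \<in> lists (range (\<lambda>z. M.cls (X z)))" "length Xs = n"
    using assms by (auto simp: tuples_def carr_X lists_eq_set)
  then obtain zs where "Xs = map (\<lambda>z. M.cls (X z)) zs" by (auto simp: lists_image)
  then show thesis using that[of zs] \<open>length Xs = n\<close> by simp
qed

text \<open>A name of the value of \<open>F\<close> on one side is a name of its value on the other,
  because being at distance 0 from that value is expressed by an atomic formula.\<close>

lemma iso_fint:
  assumes F: "F \<in> fsyms \<tau>" and zs: "length zs = farity \<tau> F"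
  shows "iso (fint M.P F (map (\<lambda>z. M.cls (X z)) zs)) = fint N.P F (map (\<lambda>z. N.cls (Y z)) zs)"
proof -
  have X: "set (map X zs) \<subseteq> M.maps" "length (map X zs) = farity \<tau> F"
    and Y: "set (map Y zs) \<subseteq> N.maps" "length (map Y zs) = farity \<tau> F"
    using X_in Y_in zs by auto
  have 1: "fint M.P F (map (\<lambda>z. M.cls (X z)) zs) = M.cls (M.fmap F (map X zs))"
    using M.fint_powermean[OF F X] by (simp add: comp_def)
  have 2: "fint N.P F (map (\<lambda>z. N.cls (Y z)) zs) = N.cls (N.fmap F (map Y zs))"
    using N.fint_powermean[OF F Y] by (simp add: comp_def)
  obtain w where w: "M.cls (X w) = M.cls (M.fmap F (map X zs))" using ex_cls_X[OF M.fmap_in[OF F X]] by blast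
  then have "M.mdist (X w) (M.fmap F (map X zs)) = 0" using M.cls_eq_iff[OF X_in M.fmap_in[OF F X]] by simp
  then have "N.cls (Y w) = N.cls (N.fmap F (map Y zs))"
    using mdist_fmap_agree[OF F zs, of w] N.cls_eq_iff[OF Y_in N.fmap_in[OF F Y]] by simp
  then show ?thesis using w 1 2 iso_cls[of w] by simp
qed

lemma iso_cint:
  assumes "c \<in> csyms \<tau>"
  shows "iso (cint M.P c) = cint N.P c"
proof -
  obtain w where w: "M.cls (X w) = cint M.P c"
    using ex_cls_X[OF M.const_in[OF assms]] unfolding M.cint_powermean by blast
  then have "M.mdist (X w) (\<lambda>i\<in>I. cint M c) = 0"
    using M.cls_eq_iff[OF X_in M.const_in[OF assms]] by (simp add: M.cint_powermean)
  then have "N.cls (Y w) = cint N.P c"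
    using mdist_const_agree[OF assms, of w] N.cls_eq_iff[OF Y_in N.const_in[OF assms]]
    by (simp add: N.cint_powermean)
  then show ?thesis using w iso_cls[of w] by simp
qed

theorem isomorphic_powermeans: "isomorphic_structures \<tau> M.P N.P"
  unfolding isomorphic_structures_def
proof (intro exI[of _ iso] conjI ballI)
  show "bij_betw iso (carr M.P) (carr N.P)"
    unfolding bij_betw_def
  proof
    show "inj_on iso (carr M.P)" unfolding carr_X by (auto simp: inj_on_def iso_cls cls_agree)
    show "iso ` carr M.P = carr N.P" unfolding carr_X carr_Y by (simp add: image_image iso_cls)
  qed
  fix C D assume "C \<in> carr M.P" "D \<in> carr M.P"
  then obtain z w where [simp]: "C = M.cls (X z)" "D = M.cls (X w)" by (auto simp: carr_X)
  show "sdist \<tau> N.P (iso C) (iso D) = sdist \<tau> M.P C D"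
    using rint_agree[OF M.dsym_ok(1), of "[z, w]"] M.dsym_ok(2)
    by (simp add: sdist_def iso_cls carr_X carr_Y)
next
  fix F Xs assume F: "F \<in> fsyms \<tau>" and "Xs \<in> tuples M.P (farity \<tau> F)"
  then obtain zs where zs: "length zs = farity \<tau> F" "Xs = map (\<lambda>z. M.cls (X z)) zs"
    using tuples_X by blast
  then show "iso (fint M.P F Xs) = fint N.P F (map iso Xs)"
    using iso_fint[OF F zs(1)] by (simp add: iso_cls comp_def)
next
  fix R Xs assume R: "R \<in> rsyms \<tau>" and "Xs \<in> tuples M.P (rarity \<tau> R)"
  then obtain zs where zs: "length zs = rarity \<tau> R" "Xs = map (\<lambda>z. M.cls (X z)) zs"
    using tuples_X by blast
  then show "rint N.P R (map iso Xs) = rint M.P R Xs"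
    using rint_agree[OF R zs(1)] by (simp add: iso_cls comp_def)
qed (rule iso_cint)

end

section \<open>A joint mean for elementarily equivalent structures\<close>

text \<open>Each atomic formula comes with its own assignment of names to variables; renaming brings
  all of them to one common numbering of the names.\<close>

fun tm_rename :: "(nat \<Rightarrow> nat) \<Rightarrow> ('f, 'c) ltm \<Rightarrow> ('f, 'c) ltm" where
  "tm_rename \<theta> (Var n) = Var (\<theta> n)"
| "tm_rename \<theta> (Const c) = Const c"
| "tm_rename \<theta> (App F ts) = App F (map (tm_rename \<theta>) ts)"

lemma tm_val_rename: "tm_val M e (tm_rename \<theta> t) = tm_val M (\<lambda>n. e (\<theta> n)) t"
proof (induction t)
  case (App F ts)
  then have "map (tm_val M e \<circ> tm_rename \<theta>) ts = map (tm_val M (\<lambda>n. e (\<theta> n))) ts" by simp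
  then show ?case by (simp only: tm_rename.simps tm_val.simps map_map)
qed auto

lemma tm_ok_rename: "tm_ok \<tau> (tm_rename \<theta> t) = tm_ok \<tau> t"
  by (induction t) auto

lemma tm_vars_rename: "tm_vars (tm_rename \<theta> t) = \<theta> ` tm_vars t"
  by (induction t) auto

lemma finite_tm_vars: "finite (tm_vars t)"
  by (induction t) auto

lemma tm_val_in:
  assumes "is_structure \<tau> M" "tm_ok \<tau> t" "\<And>n. e n \<in> carr M"
  shows "tm_val M e t \<in> carr M"
  using assms(2)
proof (induction t)
  case (App F ts)
  then show ?case by (auto intro!: is_structureD(4)[OF assms(1)] simp: tuples_def)
qed (use is_structureD(3)[OF assms(1)] assms(3) in auto)

text \<open>A bound uniform in the assignment passes through the quantifiers, and it ensures that
  the suprema and infima are taken over bounded sets.\<close>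

lemma fm_val_bounded:
  assumes "is_structure \<tau> M" "fm_ok \<tau> p"
  shows "\<exists>B. \<forall>e. (\<forall>n. e n \<in> carr M) \<longrightarrow> \<bar>fm_val M e p\<bar> \<le> B"
  using assms(2)
proof (induction p)
  case (Num r)
  show ?case by (intro exI[of _ "\<bar>r\<bar>"]) simp
next
  case (Rel R ts)
  then show ?case
    using tm_val_in[OF assms(1)] is_structureD(6)[OF assms(1), of R]
    by (intro exI[of _ "rbound \<tau> R"]) (auto simp: tuples_def image_subset_iff)
next
  case (Scale r p)
  then obtain B where "\<forall>e. (\<forall>n. e n \<in> carr M) \<longrightarrow> \<bar>fm_val M e p\<bar> \<le> B" by auto
  then show ?case by (intro exI[of _ "\<bar>r\<bar> * B"]) (simp add: abs_mult mult_left_mono)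
next
  case (Plus p q)
  then obtain B C where "\<forall>e. (\<forall>n. e n \<in> carr M) \<longrightarrow> \<bar>fm_val M e p\<bar> \<le> B"
    "\<forall>e. (\<forall>n. e n \<in> carr M) \<longrightarrow> \<bar>fm_val M e q\<bar> \<le> C" by auto
  then show ?case
    by (intro exI[of _ "B + C"]) (auto intro!: order_trans[OF abs_triangle_ineq] add_mono)
next
  case (SupQ n p)
  then obtain B where B: "\<forall>e. (\<forall>n. e n \<in> carr M) \<longrightarrow> \<bar>fm_val M e p\<bar> \<le> B" by auto
  show ?case
    by (rule exI[of _ B], intro allI impI, simp, rule cSup_abs_le)
      (use B is_structureD(1)[OF assms(1)] in auto)
next
  case (InfQ n p)
  then obtain B where B: "\<forall>e. (\<forall>n. e n \<in> carr M) \<longrightarrow> \<bar>fm_val M e p\<bar> \<le> B" by auto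
  show ?case
    by (rule exI[of _ B], intro allI impI, simp, rule cInf_abs_ge)
      (use B is_structureD(1)[OF assms(1)] in auto)
qed

lemma fm_val_quantifier_bdd:
  assumes "is_structure \<tau> M" "fm_ok \<tau> p" "\<And>n. e n \<in> carr M"
  shows "bdd_above ((\<lambda>x. fm_val M (e(n := x)) p) ` carr M)"
    "bdd_below ((\<lambda>x. fm_val M (e(n := x)) p) ` carr M)"
proof -
  obtain B where B: "\<forall>e. (\<forall>n. e n \<in> carr M) \<longrightarrow> \<bar>fm_val M e p\<bar> \<le> B"
    using fm_val_bounded[OF assms(1,2)] by blast
  have "\<bar>fm_val M (e(n := x)) p\<bar> \<le> B" if "x \<in> carr M" for x using B assms(3) that by simp
  then show "bdd_above ((\<lambda>x. fm_val M (e(n := x)) p) ` carr M)"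
    "bdd_below ((\<lambda>x. fm_val M (e(n := x)) p) ` carr M)"
    by (force intro: bdd_aboveI2[of _ _ B] simp: abs_le_iff)
      (use \<open>\<And>x. x \<in> carr M \<Longrightarrow> \<bar>fm_val M (e(n := x)) p\<bar> \<le> B\<close> in
        \<open>force intro: bdd_belowI2[of _ "- B"] simp: abs_le_iff\<close>)
qed

section \<open>Prenex formulas over linear combinations of atomic formulas\<close>

fun quantify :: "(nat \<Rightarrow> bool) \<Rightarrow> nat list \<Rightarrow> ('f, 'r, 'c) lfm \<Rightarrow> ('f, 'r, 'c) lfm" where
  "quantify q [] p = p"
| "quantify q (k # ks) p = (if q k then InfQ k (quantify q ks p) else SupQ k (quantify q ks p))"

lemma free_vars_quantify: "free_vars (quantify q ks p) = free_vars p - set ks"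
  by (induction ks) auto

lemma fm_ok_quantify: "fm_ok \<tau> (quantify q ks p) = fm_ok \<tau> p"
  by (induction ks) auto

text \<open>An entry (c, R, ts, \<sigma>) stands for c times R(ts) with variable n read as the name
  \<sigma> n; \<open>\<iota>\<close> numbers the names by variables of the resulting
  formula.\<close>

fun combination ::
  "('z \<Rightarrow> nat) \<Rightarrow> (real \<times> 'r \<times> ('f, 'c) ltm list \<times> (nat \<Rightarrow> 'z)) list \<Rightarrow> ('f, 'r, 'c) lfm" where
  "combination \<iota> [] = Num 0"
| "combination \<iota> ((c, R, ts, \<sigma>) # l) =
     Plus (Scale c (Rel R (map (tm_rename (\<lambda>n. \<iota> (\<sigma> n))) ts))) (combination \<iota> l)"

text \<open>Removing a minimal element again and again sorts the names into an order of play in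
  which nothing comes after a name while lying below it.\<close>

lemma wf_enumeration:
  assumes "wf r" "finite Z"
  shows "\<exists>zs. distinct zs \<and> set zs = Z \<and> sorted_wrt (\<lambda>z w. (w, z) \<notin> r) zs"
  using assms(2)
proof (induction "card Z" arbitrary: Z)
  case (Suc n)
  then have "Z \<noteq> {}" by auto
  then obtain z where z: "z \<in> Z" "\<And>w. (w, z) \<in> r \<Longrightarrow> w \<notin> Z"
    using wfE_min'[OF assms(1)] by metis
  have "n = card (Z - {z})" using Suc z(1) by simp
  then obtain zs where "distinct zs" "set zs = Z - {z}" "sorted_wrt (\<lambda>z w. (w, z) \<notin> r) zs"
    using Suc.hyps(1)[of "Z - {z}"] Suc.prems by auto
  then show ?case using z by (intro exI[of _ "z # zs"]) auto
qed auto

text \<open>A name \<open>z\<close> with \<open>tag z\<close> demands that the coordinate \<open>z\<close> on the side of \<open>M\<close> be the function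
  \<open>f z\<close> of coordinates of lower rank; the other names make the same demand on the side of \<open>N\<close>.\<close>

locale coordinate_side =
  fixes \<tau> :: "('f, 'r, 'c) lsig" and M :: "('a, 'f, 'r, 'c) struct" and r :: "'z rel"
    and E :: "('z \<Rightarrow> 'a) set" and f :: "'z \<Rightarrow> ('z \<Rightarrow> 'a) \<Rightarrow> 'a"
  assumes sig: "is_signature \<tau>" and str: "is_structure \<tau> M" and wf: "wf r"
    and E_ne: "E \<noteq> {}" and E_in: "e \<in> E \<Longrightarrow> e z \<in> carr M"
    and E_upd: "e \<in> E \<Longrightarrow> x \<in> carr M \<Longrightarrow> e(z := x) \<in> E"
    and f_in: "e \<in> E \<Longrightarrow> f z e \<in> carr M"
    and f_low: "e \<in> E \<Longrightarrow> e' \<in> E \<Longrightarrow> (\<And>w. (w, z) \<in> r \<Longrightarrow> e w = e' w) \<Longrightarrow> f z e = f z e'"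
begin

text \<open>Turns a quantifier over the variable \<open>k\<close> into a move at the coordinate
  named \<nu> k; injectivity of \<open>\<nu>\<close> leaves the other variables alone.\<close>

lemma fm_val_upd:
  assumes "inj_on \<nu> {..<n}" "k < n" "free_vars p \<subseteq> {..<n}"
  shows "fm_val M ((\<lambda>j. e (\<nu> j))(k := x)) p = fm_val M (\<lambda>j. (e(\<nu> k := x)) (\<nu> j)) p"
proof (rule fm_val_cong)
  fix j assume "j \<in> free_vars p"
  then have "j < n" using assms(3) by auto
  then show "((\<lambda>j. e (\<nu> j))(k := x)) j = (e(\<nu> k := x)) (\<nu> j)"
    using assms(1,2) by (auto simp: inj_on_def)
qed

text \<open>\<open>W\<close> holds the names still to be played. None of them lies below
  \<open>z\<close>, so the value forced at \<open>z\<close> is still the demanded one at the end of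
  the game.\<close>

lemma f_fixed:
  assumes "e \<in> E" "e' \<in> E" "x \<in> carr M" "z \<notin> W" "\<And>w. w \<in> W \<Longrightarrow> (w, z) \<notin> r"
    and "\<And>w. w \<notin> W \<Longrightarrow> e' w = (e(z := x)) w"
  shows "f z e' = f z e"
proof (rule f_low[OF assms(2,1)])
  fix w assume w: "(w, z) \<in> r"
  then have "w \<noteq> z" using wf by (metis wf_not_refl)
  moreover have "w \<notin> W" using assms(5) w by blast
  ultimately show "e' w = e w" using assms(6) by simp
qed

end

section \<open>The game between the two sides\<close>

locale joint_coordinates =
  M: coordinate_side \<tau> M r E f + N: coordinate_side \<tau> N r E' g
  for \<tau> :: "('f, 'r, 'c) lsig" and M :: "('a, 'f, 'r, 'c) struct" and N :: "('b, 'f, 'r, 'c) struct"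
    and r :: "'z rel" and E :: "('z \<Rightarrow> 'a) set" and f :: "'z \<Rightarrow> ('z \<Rightarrow> 'a) \<Rightarrow> 'a"
    and E' :: "('z \<Rightarrow> 'b) set" and g :: "'z \<Rightarrow> ('z \<Rightarrow> 'b) \<Rightarrow> 'b" +
  fixes tag :: "'z \<Rightarrow> bool"
  assumes equiv: "elem_equiv \<tau> M N"
begin

definition dev :: "'z \<Rightarrow> ('z \<Rightarrow> 'a) \<times> ('z \<Rightarrow> 'b) \<Rightarrow> real" where
  "dev z s = (if tag z then sdist \<tau> M (fst s z) (f z (fst s)) else sdist \<tau> N (snd s z) (g z (snd s)))"

definition gap :: "'r \<Rightarrow> ('f, 'c) ltm list \<Rightarrow> (nat \<Rightarrow> 'z) \<Rightarrow> ('z \<Rightarrow> 'a) \<times> ('z \<Rightarrow> 'b) \<Rightarrow> real" where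
  "gap R ts \<sigma> s = rint M R (map (tm_val M (\<lambda>n. fst s (\<sigma> n))) ts)
     - rint N R (map (tm_val N (\<lambda>n. snd s (\<sigma> n))) ts)"

definition gaps ::
  "(real \<times> 'r \<times> ('f, 'c) ltm list \<times> (nat \<Rightarrow> 'z)) list \<Rightarrow> ('z \<Rightarrow> 'a) \<times> ('z \<Rightarrow> 'b) \<Rightarrow> real" where
  "gaps l s = (\<Sum>(c, R, ts, \<sigma>)\<leftarrow>l. c * gap R ts \<sigma> s)"

lemma dev_nonneg: "0 \<le> dev z s"
  using sdist_bounds(1)[OF M.sig M.str] sdist_bounds(1)[OF N.sig N.str] by (simp add: dev_def)

lemma dev_le: "dev z s \<le> 1"
  using sdist_bounds(2)[OF M.sig M.str] sdist_bounds(2)[OF N.sig N.str] by (simp add: dev_def)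

text \<open>Strategy: the coordinates are chosen in order of increasing rank. At a name with \<open>tag\<close>, quantified
  by \<open>inf\<close>, the coordinate in \<open>M\<close> is forced and the one in \<open>N\<close> nearly attains the infimum; at the
  other names, quantified by \<open>sup\<close>, the roles are exchanged.\<close>

lemma strategy:
  fixes c d :: real
  assumes \<nu>: "inj_on \<nu> {..<n}" and ks: "distinct ks" "set ks \<subseteq> {..<n}"
      "sorted_wrt (\<lambda>i j. (\<nu> j, \<nu> i) \<notin> r) ks"
    and p: "free_vars p \<subseteq> {..<n}" "fm_ok \<tau> p" and d: "0 < d"
    and e: "e \<in> E" "e' \<in> E'"
    and le: "fm_val N (\<lambda>j. e' (\<nu> j)) (quantify (\<lambda>k. tag (\<nu> k)) ks p)
      \<le> fm_val M (\<lambda>j. e (\<nu> j)) (quantify (\<lambda>k. tag (\<nu> k)) ks p) + c"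
  shows "\<exists>u\<in>E. \<exists>u'\<in>E'. (\<forall>z. z \<notin> \<nu> ` set ks \<longrightarrow> u z = e z \<and> u' z = e' z) \<and>
    (\<forall>k\<in>set ks. dev (\<nu> k) (u, u') = 0) \<and>
    fm_val N (\<lambda>j. u' (\<nu> j)) p \<le> fm_val M (\<lambda>j. u (\<nu> j)) p + (c + d * length ks)"
  using ks e le
proof (induction ks arbitrary: e e' c)
  case Nil
  then show ?case by (intro bexI[of _ e] bexI[of _ e']) auto
next
  case (Cons k ks)
  define z where "z = \<nu> k"
  define p' where "p' = quantify (\<lambda>k. tag (\<nu> k)) ks p"
  have p': "free_vars p' \<subseteq> {..<n}" "fm_ok \<tau> p'"
    using p by (auto simp: p'_def free_vars_quantify fm_ok_quantify)
  have k: "k < n" using Cons.prems by simp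
  note e = Cons.prems(4,5)
  have Mval: "fm_val M ((\<lambda>j. e (\<nu> j))(k := x)) p' = fm_val M (\<lambda>j. (e(z := x)) (\<nu> j)) p'" for x
    unfolding z_def by (rule M.fm_val_upd[OF \<nu> k p'(1)])
  have Nval: "fm_val N ((\<lambda>j. e' (\<nu> j))(k := x)) p' = fm_val N (\<lambda>j. (e'(z := x)) (\<nu> j)) p'" for x
    unfolding z_def by (rule N.fm_val_upd[OF \<nu> k p'(1)])
  note Mbdd = fm_val_quantifier_bdd[OF M.str p'(2), of "\<lambda>j. e (\<nu> j)" k, unfolded Mval, OF M.E_in[OF e(1)]]
  note Nbdd = fm_val_quantifier_bdd[OF N.str p'(2), of "\<lambda>j. e' (\<nu> j)" k, unfolded Nval, OF N.E_in[OF e(2)]]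
  \<comment> \<open>A single move. The answering side pays at most \<open>d\<close>, because its
    infimum or supremum need not be attained.\<close>
  have "\<exists>x\<in>carr M. \<exists>y\<in>carr N. (tag z \<longrightarrow> x = f z e) \<and> (\<not> tag z \<longrightarrow> y = g z e') \<and>
      fm_val N (\<lambda>j. (e'(z := y)) (\<nu> j)) p' \<le> fm_val M (\<lambda>j. (e(z := x)) (\<nu> j)) p' + (c + d)"
  proof (cases "tag z")
    case True
    then have le: "(INF y\<in>carr N. fm_val N (\<lambda>j. (e'(z := y)) (\<nu> j)) p')
        \<le> (INF x\<in>carr M. fm_val M (\<lambda>j. (e(z := x)) (\<nu> j)) p') + c"
      using Cons.prems(6) unfolding quantify.simps p'_def[symmetric] z_def[symmetric]
      by (simp only: if_True fm_val.simps Mval Nval)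
    have "(INF x\<in>carr M. fm_val M (\<lambda>j. (e(z := x)) (\<nu> j)) p')
        \<le> fm_val M (\<lambda>j. (e(z := f z e)) (\<nu> j)) p'"
      by (rule cINF_lower[OF Mbdd(2) M.f_in[OF e(1)]])
    then have "(INF y\<in>carr N. fm_val N (\<lambda>j. (e'(z := y)) (\<nu> j)) p')
        < fm_val M (\<lambda>j. (e(z := f z e)) (\<nu> j)) p' + (c + d)" using le d by linarith
    then obtain y where "y \<in> carr N" "fm_val N (\<lambda>j. (e'(z := y)) (\<nu> j)) p'
        < fm_val M (\<lambda>j. (e(z := f z e)) (\<nu> j)) p' + (c + d)"
      unfolding cINF_less_iff[OF is_structureD(1)[OF N.str] Nbdd(2)] by blast
    then show ?thesis using True M.f_in[OF e(1), of z] by (intro bexI[of _ "f z e"] bexI[of _ y]) auto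
  next
    case False
    then have le: "(SUP y\<in>carr N. fm_val N (\<lambda>j. (e'(z := y)) (\<nu> j)) p')
        \<le> (SUP x\<in>carr M. fm_val M (\<lambda>j. (e(z := x)) (\<nu> j)) p') + c"
      using Cons.prems(6) unfolding quantify.simps p'_def[symmetric] z_def[symmetric]
      by (simp only: if_False fm_val.simps Mval Nval)
    have "fm_val N (\<lambda>j. (e'(z := g z e')) (\<nu> j)) p'
        \<le> (SUP y\<in>carr N. fm_val N (\<lambda>j. (e'(z := y)) (\<nu> j)) p')"
      by (rule cSUP_upper[OF N.f_in[OF e(2)] Nbdd(1)])
    then have "fm_val N (\<lambda>j. (e'(z := g z e')) (\<nu> j)) p' - (c + d)
        < (SUP x\<in>carr M. fm_val M (\<lambda>j. (e(z := x)) (\<nu> j)) p')" using le d by linarith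
    then obtain x where "x \<in> carr M" "fm_val N (\<lambda>j. (e'(z := g z e')) (\<nu> j)) p' - (c + d)
        < fm_val M (\<lambda>j. (e(z := x)) (\<nu> j)) p'"
      unfolding less_cSUP_iff[OF is_structureD(1)[OF M.str] Mbdd(1)] by blast
    then show ?thesis using False N.f_in[OF e(2), of z] by (intro bexI[of _ x] bexI[of _ "g z e'"]) auto
  qed
  then obtain x y where xy: "x \<in> carr M" "y \<in> carr N" "tag z \<Longrightarrow> x = f z e" "\<not> tag z \<Longrightarrow> y = g z e'"
    "fm_val N (\<lambda>j. (e'(z := y)) (\<nu> j)) p' \<le> fm_val M (\<lambda>j. (e(z := x)) (\<nu> j)) p' + (c + d)"
    by blast
  have "\<exists>u\<in>E. \<exists>u'\<in>E'. (\<forall>w. w \<notin> \<nu> ` set ks \<longrightarrow> u w = (e(z := x)) w \<and> u' w = (e'(z := y)) w) \<and>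
    (\<forall>k\<in>set ks. dev (\<nu> k) (u, u') = 0) \<and>
    fm_val N (\<lambda>j. u' (\<nu> j)) p \<le> fm_val M (\<lambda>j. u (\<nu> j)) p + ((c + d) + d * length ks)"
    using Cons.prems(1-3)
    by (intro Cons.IH[OF _ _ _ M.E_upd[OF e(1) xy(1)] N.E_upd[OF e(2) xy(2)] xy(5)[unfolded p'_def]]) auto
  then obtain u u' where u: "u \<in> E" "u' \<in> E'"
    and eq: "\<And>w. w \<notin> \<nu> ` set ks \<Longrightarrow> u w = (e(z := x)) w" "\<And>w. w \<notin> \<nu> ` set ks \<Longrightarrow> u' w = (e'(z := y)) w"
    and dev: "\<forall>k\<in>set ks. dev (\<nu> k) (u, u') = 0"
    and le': "fm_val N (\<lambda>j. u' (\<nu> j)) p \<le> fm_val M (\<lambda>j. u (\<nu> j)) p + ((c + d) + d * length ks)"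
    by blast
  have z: "z \<notin> \<nu> ` set ks"
    using \<nu> Cons.prems(1,2) unfolding z_def by (auto simp: inj_on_def)
  have low: "(w, z) \<notin> r" if "w \<in> \<nu> ` set ks" for w
    using Cons.prems(3) that by (auto simp: z_def)
  \<comment> \<open>The remaining moves concern names that are not below \<open>z\<close>, so they
    change neither the coordinate at \<open>z\<close> nor the demand on it.\<close>
  have "dev z (u, u') = 0"
  proof (cases "tag z")
    case True
    have "f z u = f z e" by (rule M.f_fixed[OF e(1) u(1) xy(1) z low eq(1)])
    then have "u z = f z u" using eq(1)[OF z] xy(3)[OF True] by simp
    then show ?thesis
      using True Metric_space.mdist_zero[OF is_structureD(2)[OF M.str]] M.f_in[OF u(1)] by (simp add: dev_def)
  next
    case False
    have "g z u' = g z e'" by (rule N.f_fixed[OF e(2) u(2) xy(2) z low eq(2)])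
    then have "u' z = g z u'" using eq(2)[OF z] xy(4)[OF False] by simp
    then show ?thesis
      using False Metric_space.mdist_zero[OF is_structureD(2)[OF N.str]] N.f_in[OF u(2)] by (simp add: dev_def)
  qed
  then show ?case
    using u eq dev le' by (intro bexI[of _ u] bexI[of _ u']) (auto simp: z_def algebra_simps)
qed

lemma combination_gaps:
  assumes "\<And>c R ts \<sigma> t n. (c, R, ts, \<sigma>) \<in> set l \<Longrightarrow> t \<in> set ts \<Longrightarrow> n \<in> tm_vars t \<Longrightarrow> \<nu> (\<iota> (\<sigma> n)) = \<sigma> n"
  shows "fm_val M (\<lambda>j. u (\<nu> j)) (combination \<iota> l) - fm_val N (\<lambda>j. u' (\<nu> j)) (combination \<iota> l) = gaps l (u, u')"
  using assms
proof (induction l)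
  case Nil
  then show ?case by (simp add: gaps_def)
next
  case (Cons x l)
  obtain c R ts \<sigma> where x: "x = (c, R, ts, \<sigma>)" by (cases x) auto
  have *: "map (tm_val K (\<lambda>j. e (\<nu> j))) (map (tm_rename (\<lambda>n. \<iota> (\<sigma> n))) ts) = map (tm_val K (\<lambda>n. e (\<sigma> n))) ts"
    for K :: "('x, 'f, 'r, 'c) struct" and e
  proof -
    have "tm_val K (\<lambda>n. e (\<nu> (\<iota> (\<sigma> n)))) t = tm_val K (\<lambda>n. e (\<sigma> n)) t" if "t \<in> set ts" for t
      using Cons.prems[of c R ts \<sigma> t] that x by (intro tm_val_cong) simp
    then show ?thesis by (simp add: tm_val_rename)
  qed
  have "fm_val M (\<lambda>j. u (\<nu> j)) (combination \<iota> l) - fm_val N (\<lambda>j. u' (\<nu> j)) (combination \<iota> l) = gaps l (u, u')"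
    by (rule Cons.IH, rule Cons.prems[OF list.set_intros(2)])
  then show ?case
    by (simp only: x combination.simps fm_val.simps *) (simp add: gaps_def gap_def algebra_simps)
qed

lemma combination_vars:
  assumes "\<And>c R ts \<sigma> t n. (c, R, ts, \<sigma>) \<in> set l \<Longrightarrow> t \<in> set ts \<Longrightarrow> n \<in> tm_vars t \<Longrightarrow> \<iota> (\<sigma> n) \<in> V"
  shows "free_vars (combination \<iota> l) \<subseteq> V"
  using assms
proof (induction l)
  case (Cons x l)
  obtain c R ts \<sigma> where x: "x = (c, R, ts, \<sigma>)" by (cases x) auto
  have "free_vars (combination \<iota> l) \<subseteq> V"
    by (rule Cons.IH, rule Cons.prems[OF list.set_intros(2)])
  moreover have "\<iota> (\<sigma> n) \<in> V" if "t \<in> set ts" "n \<in> tm_vars t" for t n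
    using Cons.prems[of c R ts \<sigma> t n] that x by simp
  ultimately show ?case by (auto simp: x tm_vars_rename)
qed auto

lemma combination_ok:
  assumes "\<And>c R ts \<sigma>. (c, R, ts, \<sigma>) \<in> set l \<Longrightarrow> fm_ok \<tau> (Rel R ts)"
  shows "fm_ok \<tau> (combination \<iota> l)"
  using assms
proof (induction l)
  case (Cons x l)
  obtain c R ts \<sigma> where x: "x = (c, R, ts, \<sigma>)" by (cases x) auto
  have "fm_ok \<tau> (combination \<iota> l)"
    by (rule Cons.IH, rule Cons.prems[OF list.set_intros(2)])
  then show ?case using Cons.prems[of c R ts \<sigma>] x by (simp add: tm_ok_rename)
qed auto

text \<open>The prenex closure of the combination is a linear sentence, so its values in M and N
  agree and the game starts without any deficit; only the moves cost something.\<close>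

lemma ex_small_gaps:
  assumes l: "\<And>c R ts \<sigma>. (c, R, ts, \<sigma>) \<in> set l \<Longrightarrow> fm_ok \<tau> (Rel R ts)"
    and Z: "finite Z" and d: "0 < d"
  shows "\<exists>s\<in>E \<times> E'. (\<forall>z\<in>Z. dev z s = 0) \<and> - d \<le> gaps l s"
proof -
  \<comment> \<open>The names in the formula are played along with those of \<open>Z\<close>, so
    that quantifying over all of them leaves a sentence.\<close>
  define Z' where "Z' = Z \<union> (\<Union>(c, R, ts, \<sigma>)\<in>set l. \<Union>t\<in>set ts. \<sigma> ` tm_vars t)"
  have "finite Z'" using Z finite_tm_vars by (auto simp: Z'_def)
  from wf_enumeration[OF M.wf this] obtain zs where zs: "distinct zs" "set zs = Z'"
    "sorted_wrt (\<lambda>z w. (w, z) \<notin> r) zs" by blast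
  define n where "n = length zs"
  define \<nu> where "\<nu> k = zs ! k" for k
  have \<nu>: "inj_on \<nu> {..<n}" using zs(1) by (simp add: inj_on_def \<nu>_def n_def nth_eq_iff_index_eq)
  have im: "\<nu> ` {..<n} = Z'" using zs(2) by (auto simp: \<nu>_def n_def set_conv_nth)
  define \<iota> where "\<iota> = inv_into {..<n} \<nu>"
  have \<iota>: "\<nu> (\<iota> z) = z" "\<iota> z < n" if "z \<in> Z'" for z
    using that im f_inv_into_f[of z \<nu> "{..<n}"] inv_into_into[of z \<nu> "{..<n}"] by (auto simp: \<iota>_def)
  define p where "p = combination \<iota> l"
  have in_Z': "\<sigma> n \<in> Z'" if "(c, R, ts, \<sigma>) \<in> set l" "t \<in> set ts" "n \<in> tm_vars t" for c R ts \<sigma> t n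
    using that unfolding Z'_def by blast
  have p: "free_vars p \<subseteq> {..<n}" "fm_ok \<tau> p"
    unfolding p_def using in_Z' \<iota>(2) l by (auto intro!: combination_vars combination_ok)
  define \<phi> where "\<phi> = quantify (\<lambda>k. tag (\<nu> k)) [0..<n] p"
  have "sentence \<tau> \<phi>"
    using p by (auto simp: \<phi>_def sentence_def free_vars_quantify fm_ok_quantify)
  then have \<phi>: "fm_val N e' \<phi> = fm_val M e \<phi>" for e e'
    using equiv fm_val_sentence by (metis elem_equiv_def)
  obtain e e' where e: "e \<in> E" "e' \<in> E'" using M.E_ne N.E_ne by blast
  \<comment> \<open>The n moves together cost n * d / (n + 1), which is at most \<open>d\<close>;
    the successor covers n = 0.\<close>
  define d' where "d' = d / Suc n"
  have d': "0 < d'" "d' * n \<le> d" using d by (auto simp: d'_def field_simps)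
  have "sorted_wrt (\<lambda>i j. (\<nu> j, \<nu> i) \<notin> r) [0..<n]"
    using zs(3) by (simp add: sorted_wrt_iff_nth_less \<nu>_def n_def)
  moreover have "set [0..<n] \<subseteq> {..<n}" by auto
  moreover have "fm_val N (\<lambda>j. e' (\<nu> j)) (quantify (\<lambda>k. tag (\<nu> k)) [0..<n] p)
      \<le> fm_val M (\<lambda>j. e (\<nu> j)) (quantify (\<lambda>k. tag (\<nu> k)) [0..<n] p) + 0"
    using \<phi>[unfolded \<phi>_def, where e = "\<lambda>j. e (\<nu> j)" and e' = "\<lambda>j. e' (\<nu> j)"] by simp
  ultimately obtain u u' where u: "u \<in> E" "u' \<in> E'"
    "\<And>k. k < n \<Longrightarrow> dev (\<nu> k) (u, u') = 0"
    "fm_val N (\<lambda>j. u' (\<nu> j)) p \<le> fm_val M (\<lambda>j. u (\<nu> j)) p + d' * n"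
    using strategy[OF \<nu> distinct_upt _ _ p d'(1) e, of 0 n 0] by auto
  have "gaps l (u, u') = fm_val M (\<lambda>j. u (\<nu> j)) p - fm_val N (\<lambda>j. u' (\<nu> j)) p"
    unfolding p_def using in_Z' \<iota>(1) by (intro combination_gaps[symmetric]) blast
  moreover have "\<forall>z\<in>Z. dev z (u, u') = 0"
    using u(3) \<iota> by (metis UnI1 Z'_def)
  ultimately show ?thesis using u d'(2) by (intro bexI[of _ "(u, u')"]) auto
qed

section \<open>From the finite games to a joint mean\<close>

lemma bdd_rint:
  assumes "fm_ok \<tau> (Rel R ts)"
  shows "(\<lambda>s. rint M R (map (tm_val M (\<lambda>n. fst s (\<sigma> n))) ts)) \<in> bdd_funs (E \<times> E')"
    and "(\<lambda>s. rint N R (map (tm_val N (\<lambda>n. snd s (\<sigma> n))) ts)) \<in> bdd_funs (E \<times> E')"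
proof -
  have "tm_val M (\<lambda>n. fst s (\<sigma> n)) t \<in> carr M" "tm_val N (\<lambda>n. snd s (\<sigma> n)) t \<in> carr N"
    if "s \<in> E \<times> E'" "t \<in> set ts" for s t
    using that assms M.E_in[of "fst s"] N.E_in[of "snd s"]
    by (auto intro!: tm_val_in[OF M.str, of t] tm_val_in[OF N.str, of t])
  note val_in = this
  show "(\<lambda>s. rint M R (map (tm_val M (\<lambda>n. fst s (\<sigma> n))) ts)) \<in> bdd_funs (E \<times> E')"
    using assms by (intro bdd_funsI[of _ _ "rbound \<tau> R"] is_structureD(6)[OF M.str])
      (use val_in(1) in \<open>auto simp: tuples_def\<close>)
  show "(\<lambda>s. rint N R (map (tm_val N (\<lambda>n. snd s (\<sigma> n))) ts)) \<in> bdd_funs (E \<times> E')"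
    using assms by (intro bdd_funsI[of _ _ "rbound \<tau> R"] is_structureD(6)[OF N.str])
      (use val_in(2) in \<open>auto simp: tuples_def\<close>)
qed

lemma bdd_funs_gap: "fm_ok \<tau> (Rel R ts) \<Longrightarrow> gap R ts \<sigma> \<in> bdd_funs (E \<times> E')"
  unfolding gap_def[abs_def] by (intro bdd_funs_diff bdd_rint)

lemma ex_joint_mean:
  "\<exists>L. mean (E \<times> E') L \<and> (\<forall>z. L (dev z) = 0) \<and>
    (\<forall>R ts \<sigma>. fm_ok \<tau> (Rel R ts) \<longrightarrow> L (gap R ts \<sigma>) = 0)"
proof -
  \<comment> \<open>In place of a span with explicit coefficients: \<open>h\<close> is a combination
    of gaps up to a multiple of a finite sum of deviations. This is stable under linear operations,
    covers every gap and every deviation, and forces \<open>h\<close> to equal \<open>gaps l\<close>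
    wherever those deviations vanish.\<close>
  define controlled where "controlled h l Z C \<longleftrightarrow> (\<forall>(c, R, ts, \<sigma>)\<in>set l. fm_ok \<tau> (Rel R ts)) \<and>
    finite Z \<and> 0 \<le> C \<and> (\<forall>s\<in>E \<times> E'. \<bar>h s - gaps l s\<bar> \<le> C * (\<Sum>z\<in>Z. dev z s))" for h l Z and C :: real
  define G where "G = {h \<in> bdd_funs (E \<times> E'). \<exists>l Z C. controlled h l Z C}"
  have "fun_subspace G"
    unfolding fun_subspace_def
  proof (intro conjI ballI allI)
    have "controlled (\<lambda>_. 0) [] {} 0" by (simp add: controlled_def gaps_def)
    then show "G \<noteq> {}" unfolding G_def using bdd_funs_const by blast
  next
    fix h h' assume "h \<in> G" "h' \<in> G"
    then obtain l Z C l' Z' C' where c: "controlled h l Z C" "controlled h' l' Z' C'"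
      "h \<in> bdd_funs (E \<times> E')" "h' \<in> bdd_funs (E \<times> E')"
      unfolding G_def by blast
    have "controlled (\<lambda>s. h s + h' s) (l @ l') (Z \<union> Z') (C + C')"
      unfolding controlled_def
    proof (intro conjI ballI)
      fix s assume s: "s \<in> E \<times> E'"
      have fin: "finite (Z \<union> Z')" using c by (auto simp: controlled_def)
      have "C * (\<Sum>z\<in>Z. dev z s) \<le> C * (\<Sum>z\<in>Z \<union> Z'. dev z s)"
        using c fin dev_nonneg by (intro mult_left_mono sum_mono2) (auto simp: controlled_def)
      moreover have "C' * (\<Sum>z\<in>Z'. dev z s) \<le> C' * (\<Sum>z\<in>Z \<union> Z'. dev z s)"
        using c fin dev_nonneg by (intro mult_left_mono sum_mono2) (auto simp: controlled_def)
      moreover have "\<bar>h s - gaps l s\<bar> \<le> C * (\<Sum>z\<in>Z. dev z s)" "\<bar>h' s - gaps l' s\<bar> \<le> C' * (\<Sum>z\<in>Z'. dev z s)"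
        using c s by (auto simp: controlled_def)
      moreover have "gaps (l @ l') s = gaps l s + gaps l' s" by (simp add: gaps_def)
      ultimately show "\<bar>h s + h' s - gaps (l @ l') s\<bar> \<le> (C + C') * (\<Sum>z\<in>Z \<union> Z'. dev z s)"
        unfolding distrib_right by linarith
    qed (use c in \<open>auto simp: controlled_def\<close>)
    then show "(\<lambda>s. h s + h' s) \<in> G" unfolding G_def using c bdd_funs_add by blast
  next
    fix h k assume "h \<in> G"
    then obtain l Z C where c: "controlled h l Z C" "h \<in> bdd_funs (E \<times> E')" unfolding G_def by blast
    define l' where "l' = map (\<lambda>(c, x). (k * c, x)) l"
    have "controlled (\<lambda>s. k * h s) l' Z (\<bar>k\<bar> * C)"
      unfolding controlled_def
    proof (intro conjI ballI)
      fix s assume s: "s \<in> E \<times> E'"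
      have "gaps l' s = k * gaps l s"
        unfolding gaps_def l'_def by (induction l) (auto simp: algebra_simps)
      then have "\<bar>k * h s - gaps l' s\<bar> = \<bar>k\<bar> * \<bar>h s - gaps l s\<bar>"
        by (simp add: abs_mult flip: right_diff_distrib)
      also have "\<dots> \<le> \<bar>k\<bar> * (C * (\<Sum>z\<in>Z. dev z s))"
        using c s by (intro mult_left_mono) (auto simp: controlled_def)
      finally show "\<bar>k * h s - gaps l' s\<bar> \<le> \<bar>k\<bar> * C * (\<Sum>z\<in>Z. dev z s)" by (simp add: mult.assoc)
    qed (use c in \<open>auto simp: controlled_def l'_def\<close>)
    then show "(\<lambda>s. k * h s) \<in> G" unfolding G_def using c bdd_funs_scale by blast
  qed
  moreover have "G \<subseteq> bdd_funs (E \<times> E')" by (auto simp: G_def)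
  moreover have "\<exists>s\<in>E \<times> E'. - d \<le> h s" if h: "h \<in> G" "0 < d" for h d
  proof -
    obtain l Z C where c: "controlled h l Z C" using h unfolding G_def by blast
    then obtain s where s: "s \<in> E \<times> E'" "\<forall>z\<in>Z. dev z s = 0" "- d \<le> gaps l s"
      using ex_small_gaps[of l Z d] h by (fastforce simp: controlled_def)
    then have "\<bar>h s - gaps l s\<bar> \<le> C * (\<Sum>z\<in>Z. dev z s)" using c unfolding controlled_def by blast
    also have "(\<Sum>z\<in>Z. dev z s) = 0" using s(2) by simp
    finally show ?thesis using s by (intro bexI[of _ s]) auto
  qed
  ultimately obtain L where L: "mean (E \<times> E') L" "\<And>h. h \<in> G \<Longrightarrow> L h = 0"
    using ex_mean_vanishing[of G "E \<times> E'"] by metis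
  have "dev z \<in> G" for z
  proof -
    have "controlled (dev z) [] {z} 1" using dev_nonneg by (simp add: controlled_def gaps_def)
    moreover have "dev z \<in> bdd_funs (E \<times> E')"
      using dev_nonneg[of z] dev_le[of z] by (intro bdd_funsI[of _ _ 1]) simp
    ultimately show ?thesis unfolding G_def by blast
  qed
  moreover have "gap R ts \<sigma> \<in> G" if "fm_ok \<tau> (Rel R ts)" for R ts \<sigma>
  proof -
    have "controlled (gap R ts \<sigma>) [(1, R, ts, \<sigma>)] {} 0" using that by (simp add: controlled_def gaps_def)
    then show ?thesis unfolding G_def using bdd_funs_gap[OF that] by blast
  qed
  ultimately show ?thesis using L by blast
qed

end

section \<open>Index sets of finitely supported functions\<close>

lemma card_of_finite_le_infinite:
  assumes "finite A" "infinite B"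
  shows "|A| \<le>o |B|"
  using assms card_of_ordLeq_finite ordLeq_total[OF card_of_Well_order card_of_Well_order] by metis

text \<open>Allows a set of lists over \<open>'k\<close> to be stored as a subset of
  \<open>'k\<close>; this is how functions, names and points are packed into the index type.\<close>

lemma ex_inj_list:
  assumes "infinite (UNIV :: 'k set)"
  shows "\<exists>h :: 'k list \<Rightarrow> 'k. inj h"
proof -
  have len: "|{l :: 'k list. length l = n}| \<le>o |UNIV :: 'k set|" for n
  proof (induction n)
    case 0
    have "{l :: 'k list. length l = 0} = {[]}" by auto
    then show ?case using assms by (simp add: card_of_finite_le_infinite)
  next
    case (Suc n)
    have "{l :: 'k list. length l = Suc n} = (\<Union>x. (#) x ` {l. length l = n})"
      by (auto simp: length_Suc_conv)
    moreover have "|(#) x ` {l. length l = n}| \<le>o |UNIV :: 'k set|" for x :: 'k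
      by (rule ordLeq_transitive[OF card_of_image Suc])
    ultimately show ?case
      using card_of_UNION_ordLeq_infinite[OF assms card_of_mono1[OF subset_refl],
          of "\<lambda>x. (#) x ` {l. length l = n}"]
      by simp
  qed
  have "|UNIV :: nat set| \<le>o |UNIV :: 'k set|" using assms infinite_iff_card_of_nat by blast
  then have "|\<Union>n. {l :: 'k list. length l = n}| \<le>o |UNIV :: 'k set|"
    using len by (intro card_of_UNION_ordLeq_infinite[OF assms] ballI)
  moreover have "(\<Union>n. {l :: 'k list. length l = n}) = UNIV" by auto
  ultimately show ?thesis by (simp flip: card_of_ordLeq)
qed

text \<open>The tag selects the side of the demand, the first set encodes the demanded map and the
  second set carries the rank.\<close>

type_synonym 'k name = "bool \<times> 'k set \<times> 'k set"

definition small :: "'k itself \<Rightarrow> 'x set \<Rightarrow> bool" where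
  "small _ T \<longleftrightarrow> |T| \<le>o |UNIV :: 'k set|"

definition depends :: "('z \<Rightarrow> 'a) set \<Rightarrow> 'z set \<Rightarrow> (('z \<Rightarrow> 'a) \<Rightarrow> 'y) \<Rightarrow> bool" where
  "depends E T m \<longleftrightarrow> (\<forall>e\<in>E. \<forall>e'\<in>E. (\<forall>z\<in>T. e z = e' z) \<longrightarrow> m e = m e')"

lemma dependsD: "depends E T m \<Longrightarrow> e \<in> E \<Longrightarrow> e' \<in> E \<Longrightarrow> (\<And>z. z \<in> T \<Longrightarrow> e z = e' z) \<Longrightarrow> m e = m e'"
  unfolding depends_def by blast

lemma dependsD_UN:
  assumes "depends E (T w) m" "w \<in> W" "e \<in> E" "e' \<in> E" "\<forall>z\<in>\<Union>w\<in>W. T w. e z = e' z"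
  shows "m e = m e'"
  by (rule dependsD[OF assms(1,3,4)]) (use assms(2,5) in blast)

lemma depends_mono: "depends E T m \<Longrightarrow> T \<subseteq> T' \<Longrightarrow> depends E T' m"
  unfolding depends_def by blast

text \<open>The rank of a name is an element of the cardinal successor of the cardinality of \<open>'k\<close>, whose
  field is a set of subsets of \<open>'k\<close>.\<close>

definition successor :: "'k itself \<Rightarrow> 'k set rel" where
  "successor _ = cardSuc |UNIV :: 'k set|"

definition rank :: "'k name \<Rightarrow> 'k set" where
  "rank z = (let w = snd (snd z); S = Field (successor TYPE('k)) in if w \<in> S then w else SOME w. w \<in> S)"

definition lower :: "'k name rel" where
  "lower = {(z, w). rank z \<noteq> rank w \<and> (rank z, rank w) \<in> successor TYPE('k)}"

lemma Card_order_successor: "Card_order (successor TYPE('k))"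
  unfolding successor_def by (rule cardSuc_Card_order[OF card_of_Card_order])

lemma wf_lower: "wf (lower :: 'k name rel)"
proof -
  have "wf (successor TYPE('k) - Id)"
    using Card_order_successor[where 'k = 'k] unfolding card_order_on_def well_order_on_def by blast
  then have "wf (inv_image (successor TYPE('k) - Id) rank)" by (rule wf_inv_image)
  moreover have "lower = inv_image (successor TYPE('k) - Id) rank"
    by (auto simp: lower_def inv_image_def)
  ultimately show ?thesis by simp
qed

lemma infinite_successor:
  assumes "infinite (UNIV :: 'k set)"
  shows "infinite (Field (successor TYPE('k)))"
  using cardSuc_finite[OF card_of_Card_order, of "UNIV :: 'k set"] assms
  by (simp add: successor_def Field_card_of)

lemma rank_in:
  assumes "infinite (UNIV :: 'k set)"
  shows "rank (z :: 'k name) \<in> Field (successor TYPE('k))"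
proof -
  have "Field (successor TYPE('k)) \<noteq> {}" using infinite_successor[OF assms] by auto
  then have "(SOME w. w \<in> Field (successor TYPE('k))) \<in> Field (successor TYPE('k))"
    by (simp add: some_in_eq)
  then show ?thesis by (simp add: rank_def Let_def)
qed

text \<open>The successor cardinal is regular, so at most K ranks are not cofinal in it. The tag and
  the encoded map can be prescribed freely, since the rank only reads the last component.\<close>

lemma small_bounded:
  assumes inf: "infinite (UNIV :: 'k set)" and T: "small TYPE('k) (T :: 'k name set)"
  shows "\<exists>w. T \<subseteq> {v. (v, (t, u, w)) \<in> lower}"
proof -
  let ?r = "successor TYPE('k)"
  have "|rank ` T| \<le>o |UNIV :: 'k set|"
    using T card_of_image ordLeq_transitive unfolding small_def by blast
  moreover have "|UNIV :: 'k set| <o ?r" unfolding successor_def by (rule cardSuc_greater[OF card_of_Card_order])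
  ultimately have "\<not> |rank ` T| =o ?r"
    using ordLeq_ordLess_trans not_ordLess_ordIso by blast
  moreover have "regularCard ?r" unfolding successor_def
    by (rule infinite_cardSuc_regularCard[OF _ card_of_Card_order]) (use inf in \<open>simp add: Field_card_of\<close>)
  moreover have "rank ` T \<subseteq> Field ?r" using rank_in[OF inf] by auto
  ultimately have "\<not> cofinal (rank ` T) ?r" unfolding regularCard_def by blast
  then obtain a where a: "a \<in> Field ?r" "\<And>b. b \<in> rank ` T \<Longrightarrow> a = b \<or> (a, b) \<notin> ?r"
    unfolding cofinal_def by blast
  \<comment> \<open>\<open>a\<close> bounds the ranks only weakly; an infinite cardinal has no last
    element, so one step further the bound is strict.\<close>
  obtain w where w: "w \<in> Field ?r" "a \<noteq> w" "(a, w) \<in> ?r"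
    using infinite_Card_order_limit[OF Card_order_successor infinite_successor[OF inf] a(1)] by blast
  have ord: "well_order_on (Field ?r) ?r"
    using Card_order_successor[where 'k = 'k] by (simp add: card_order_on_def)
  then have lin: "trans ?r" "antisym ?r" "total_on (Field ?r) ?r" "refl_on (Field ?r) ?r"
    by (auto simp: well_order_on_def linear_order_on_def partial_order_on_def preorder_on_def)
  have rw: "rank (t, u, w) = w" using w(1) by (simp add: rank_def)
  have "(v, (t, u, w)) \<in> lower" if v: "v \<in> T" for v
  proof -
    have "(rank v, a) \<in> ?r"
      using a(2)[of "rank v"] a(1) rank_in[OF inf, of v] lin(3,4) v
      unfolding total_on_def refl_on_def by fastforce
    then have "(rank v, w) \<in> ?r" "rank v \<noteq> w"
      using w lin(1,2) by (auto dest: transD antisymD)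
    then show ?thesis by (simp add: lower_def rw)
  qed
  then show ?thesis by blast
qed

section \<open>The coordinate space of one structure and its algebra\<close>

locale finite_support =
  fixes \<tau> :: "('f, 'r, 'c) lsig" and M :: "('a, 'f, 'r, 'c) struct" and x\<^sub>0 :: 'a
    and code :: "'k list \<Rightarrow> 'k" and point :: "'a \<Rightarrow> 'k"
  assumes sig: "is_signature \<tau>" and str: "is_structure \<tau> M" and x\<^sub>0: "x\<^sub>0 \<in> carr M"
    and code: "inj code" and point: "inj point" and inf: "infinite (UNIV :: 'k set)"
begin

abbreviation sm :: "'k name set \<Rightarrow> bool" where
  "sm T \<equiv> small TYPE('k) T"

definition fsfun :: "('k name \<Rightarrow> 'a) set" where
  "fsfun = {e. (\<forall>z. e z \<in> carr M) \<and> finite {z. e z \<noteq> x\<^sub>0}}"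

text \<open>The length of a list tells what it describes: 0 the tag, 1 and 2 the two sets of the
  name, 3 the value.\<close>

definition pair_code :: "'k name \<Rightarrow> 'a \<Rightarrow> 'k list set" where
  "pair_code z x = {l. l = [] \<and> fst z} \<union> {[k] |k. k \<in> fst (snd z)} \<union>
     {[k, k] |k. k \<in> snd (snd z)} \<union> {[point x, point x, point x]}"

text \<open>The graph of \<open>e\<close>, with each of its pairs encoded as a subset of
  \<open>'k\<close>; it transports the functions into the prescribed index type.\<close>

definition enc :: "('k name \<Rightarrow> 'a) \<Rightarrow> 'k set set" where
  "enc e = range (\<lambda>z. code ` pair_code z (e z))"

definition idx :: "'k set set set" where
  "idx = enc ` fsfun"

definition coord :: "'k name \<Rightarrow> 'k set set \<Rightarrow> 'a" where
  "coord z = (\<lambda>i\<in>idx. inv_into fsfun enc i z)"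

definition alg :: "'k set set set set" where
  "alg = {X. X \<subseteq> idx \<and> (\<exists>T. sm T \<and> depends fsfun T (\<lambda>e. enc e \<in> X))}"

text \<open>The measurable maps as functions of the coordinates: since singletons are Borel, a map is
  measurable iff it depends on few coordinates only.\<close>

definition smaps :: "(('k name \<Rightarrow> 'a) \<Rightarrow> 'a) set" where
  "smaps = {m \<in> fsfun \<rightarrow>\<^sub>E carr M. \<exists>T. sm T \<and> depends fsfun T m}"

lemma fsfun_in: "e \<in> fsfun \<Longrightarrow> e z \<in> carr M"
  unfolding fsfun_def by blast

lemma fsfun_ne: "fsfun \<noteq> {}"
  using x\<^sub>0 by (auto simp: fsfun_def intro!: exI[of _ "\<lambda>_. x\<^sub>0"])

lemma fsfun_upd: "e \<in> fsfun \<Longrightarrow> x \<in> carr M \<Longrightarrow> e(z := x) \<in> fsfun"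
  unfolding fsfun_def
  by (auto elim!: rev_finite_subset[OF finite_insert[THEN iffD2], where a2 = z])

lemma pair_code_inject:
  assumes "pair_code z x = pair_code w y"
  shows "z = w \<and> x = y"
proof -
  note c = assms[unfolded pair_code_def]
  have "fst z = fst w" using arg_cong[OF c, of "\<lambda>C. [] \<in> C"] by simp
  moreover have "k \<in> fst (snd z) \<longleftrightarrow> k \<in> fst (snd w)" for k
    using arg_cong[OF c, of "\<lambda>C. [k] \<in> C"] by simp
  moreover have "k \<in> snd (snd z) \<longleftrightarrow> k \<in> snd (snd w)" for k
    using arg_cong[OF c, of "\<lambda>C. [k, k] \<in> C"] by simp
  moreover have "point x = point y"
    using arg_cong[OF c, of "\<lambda>C. [point x, point x, point x] \<in> C"] by simp
  then have "x = y" by (rule injD[OF point])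
  ultimately show ?thesis by (simp add: prod_eq_iff set_eq_iff)
qed

lemma inj_enc: "inj enc"
proof (rule injI, rule ext)
  fix e e' :: "'k name \<Rightarrow> 'a" and z
  assume eq: "enc e = enc e'"
  have "code ` pair_code z (e z) \<in> enc e" unfolding enc_def by (rule rangeI)
  then obtain w where "code ` pair_code z (e z) = code ` pair_code w (e' w)"
    unfolding eq unfolding enc_def by blast
  then have "pair_code z (e z) = pair_code w (e' w)" unfolding inj_image_eq_iff[OF code] .
  then show "e z = e' z" using pair_code_inject by metis
qed

lemma coord_enc: "e \<in> fsfun \<Longrightarrow> coord z (enc e) = e z"
  using inv_into_f_f[OF inj_on_subset[OF inj_enc]] by (simp add: coord_def idx_def)

lemma small_UN: "|W| \<le>o |UNIV :: 'k set| \<Longrightarrow> (\<And>w. w \<in> W \<Longrightarrow> sm (T w)) \<Longrightarrow> sm (\<Union>w\<in>W. T w)"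
  unfolding small_def using card_of_UNION_ordLeq_infinite[OF inf] by blast

lemma finite_small: "finite W \<Longrightarrow> |W| \<le>o |UNIV :: 'k set|"
  using card_of_finite_le_infinite inf by blast

lemma points_small: "|W :: 'a set| \<le>o |UNIV :: 'k set|"
  using point card_of_ordLeq[of W "UNIV :: 'k set"] by (metis inj_on_subset subset_UNIV)

lemma algI: "X \<subseteq> idx \<Longrightarrow> sm T \<Longrightarrow> depends fsfun T (\<lambda>e. enc e \<in> X) \<Longrightarrow> X \<in> alg"
  unfolding alg_def by blast

text \<open>The union of at most K supports of size at most K is again a support of size at most K,
  as K is infinite.\<close>

lemma alg_Union:
  assumes "\<X> \<subseteq> alg" "|\<X>| \<le>o |UNIV :: 'k set|"
  shows "\<Union>\<X> \<in> alg"
proof -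
  have "\<forall>X\<in>\<X>. \<exists>T. sm T \<and> depends fsfun T (\<lambda>e. enc e \<in> X)"
    using assms(1) unfolding alg_def by blast
  from bchoice[OF this] obtain T
    where "\<forall>X\<in>\<X>. sm (T X) \<and> depends fsfun (T X) (\<lambda>e. enc e \<in> X)" ..
  note T = bspec[OF this]
  show ?thesis
  proof (rule algI)
    show "\<Union>\<X> \<subseteq> idx" using assms(1) by (auto simp: alg_def)
    show "sm (\<Union>X\<in>\<X>. T X)" using T by (intro small_UN[OF assms(2)]) blast
    show "depends fsfun (\<Union>X\<in>\<X>. T X) (\<lambda>e. enc e \<in> \<Union>\<X>)"
      unfolding depends_def
    proof (intro ballI impI)
      fix e e' assume e: "e \<in> fsfun" "e' \<in> fsfun" "\<forall>z\<in>\<Union>X\<in>\<X>. T X. e z = e' z"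
      have "(enc e \<in> X) = (enc e' \<in> X)" if "X \<in> \<X>" for X
        by (rule dependsD_UN[OF conjunct2[OF T[OF that]] that e])
      then show "(enc e \<in> \<Union>\<X>) = (enc e' \<in> \<Union>\<X>)" by blast
    qed
  qed
qed

lemma algebra_alg: "algebra idx alg"
  unfolding algebra_iff_Un
proof (intro conjI ballI)
  show "alg \<subseteq> Pow idx" by (auto simp: alg_def)
  show "{} \<in> alg" by (rule algI[of _ "{}"]) (auto simp: small_def depends_def card_of_empty)
next
  fix X assume "X \<in> alg"
  then obtain T where T: "sm T" "depends fsfun T (\<lambda>e. enc e \<in> X)" unfolding alg_def by blast
  show "idx - X \<in> alg"
  proof (rule algI[OF _ T(1)])
    show "depends fsfun T (\<lambda>e. enc e \<in> idx - X)"
      using T(2) unfolding depends_def idx_def by blast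
  qed auto
next
  fix X Y assume "X \<in> alg" "Y \<in> alg"
  then have "\<Union>{X, Y} \<in> alg" by (intro alg_Union finite_small) auto
  then show "X \<union> Y \<in> alg" by simp
qed

text \<open>The whole carrier serves as the dense set; it has at most K points because
  \<open>point\<close> is injective.\<close>

lemma meanable: "meanable \<tau> M alg"
  unfolding meanable_def
proof (intro exI[of _ "|UNIV :: 'a set|"] conjI)
  interpret Metric_space "carr M" "sdist \<tau> M" using is_structureD(2)[OF str] .
  show "\<exists>D\<subseteq>carr M. mtopology closure_of D = carr M \<and> |D| \<le>o |UNIV :: 'a set|"
    using closure_of_topspace[of mtopology] by (intro exI[of _ "carr M"]) (simp add: card_of_mono1)
  show "\<forall>\<X>\<subseteq>alg. |\<X>| \<le>o |UNIV :: 'a set| \<longrightarrow> \<Union>\<X> \<in> alg"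
    using alg_Union ordLeq_transitive[OF _ points_small] by blast
qed (rule card_of_Card_order)

text \<open>The preimage of each singleton has a support of size at most K; there are at most K
  points, so the union of these supports is small, and it determines the value.\<close>

lemma mmaps_depends:
  assumes a: "a \<in> mmaps \<tau> M idx alg"
  shows "\<exists>T. sm T \<and> depends fsfun T (\<lambda>e. a (enc e))"
proof -
  interpret Metric_space "carr M" "sdist \<tau> M" using is_structureD(2)[OF str] .
  have a_in: "a (enc e) \<in> carr M" if "e \<in> fsfun" for e
    using a that by (auto simp: mmaps_def idx_def)
  have "\<exists>T. sm T \<and> depends fsfun T (\<lambda>e. a (enc e) = x)" if x: "x \<in> carr M" for x
  proof -
    have "openin mtopology (carr M - {x})"
      using closedin_Hausdorff_sing_eq[OF Hausdorff_space_mtopology, of x] x by (simp add: closedin_def)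
    then have "carr M - (carr M - {x}) \<in> borel_subsets \<tau> M"
      unfolding borel_subsets_def by (intro sigma_sets.Compl sigma_sets.Basic) simp
    moreover have "carr M - (carr M - {x}) = {x}" using x by auto
    moreover have "\<forall>X\<in>borel_subsets \<tau> M. {i \<in> idx. a i \<in> X} \<in> alg" using a by (simp add: mmaps_def)
    ultimately have "{i \<in> idx. a i \<in> {x}} \<in> alg" by metis
    then obtain T where T: "sm T" "depends fsfun T (\<lambda>e. enc e \<in> {i \<in> idx. a i \<in> {x}})" unfolding alg_def by blast
    have "depends fsfun T (\<lambda>e. a (enc e) = x)"
      using T(2) unfolding depends_def idx_def by blast
    then show ?thesis using T(1) by blast
  qed
  then have "\<forall>x\<in>carr M. \<exists>T. sm T \<and> depends fsfun T (\<lambda>e. a (enc e) = x)" by (rule ballI)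
  from bchoice[OF this] obtain T
    where "\<forall>x\<in>carr M. sm (T x) \<and> depends fsfun (T x) (\<lambda>e. a (enc e) = x)" ..
  note T = bspec[OF this]
  show ?thesis
  proof (intro exI conjI)
    show "sm (\<Union>x\<in>carr M. T x)" using T by (intro small_UN points_small) blast
    show "depends fsfun (\<Union>x\<in>carr M. T x) (\<lambda>e. a (enc e))"
      unfolding depends_def
    proof (intro ballI impI)
      fix e e' assume e: "e \<in> fsfun" "e' \<in> fsfun" "\<forall>z\<in>\<Union>x\<in>carr M. T x. e z = e' z"
      \<comment> \<open>The support of the preimage of the point \<open>a (enc e)\<close> itself is
        contained in the union.\<close>
      have "(a (enc e) = a (enc e)) = (a (enc e') = a (enc e))"
        by (rule dependsD_UN[OF conjunct2[OF T[OF a_in[OF e(1)]]] a_in[OF e(1)] e])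
      then show "a (enc e) = a (enc e')" by simp
    qed
  qed
qed

lemma discr:
  assumes "set as \<subseteq> mmaps \<tau> M idx alg"
  shows "{i \<in> idx. P (map (\<lambda>a. a i) as)} \<in> alg"
proof -
  have "\<forall>a\<in>set as. \<exists>T. sm T \<and> depends fsfun T (\<lambda>e. a (enc e))"
    using mmaps_depends assms by blast
  from bchoice[OF this] obtain T
    where "\<forall>a\<in>set as. sm (T a) \<and> depends fsfun (T a) (\<lambda>e. a (enc e))" ..
  note T = bspec[OF this]
  show ?thesis
  proof (rule algI)
    show "sm (\<Union>a\<in>set as. T a)" using T by (intro small_UN finite_small) auto
    show "depends fsfun (\<Union>a\<in>set as. T a) (\<lambda>e. enc e \<in> {i \<in> idx. P (map (\<lambda>a. a i) as)})"
      unfolding depends_def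
    proof (intro ballI impI)
      fix e e' assume e: "e \<in> fsfun" "e' \<in> fsfun" "\<forall>z\<in>\<Union>a\<in>set as. T a. e z = e' z"
      have "a (enc e) = a (enc e')" if "a \<in> set as" for a
        by (rule dependsD_UN[OF conjunct2[OF T[OF that]] that e])
      then have "map (\<lambda>a. a (enc e)) as = map (\<lambda>a. a (enc e')) as" by (intro map_cong refl)
      then show "(enc e \<in> {i \<in> idx. P (map (\<lambda>a. a i) as)}) = (enc e' \<in> {i \<in> idx. P (map (\<lambda>a. a i) as)})"
        using e(1,2) by (simp only: idx_def mem_Collect_eq imageI simp_thms)
    qed
  qed auto
qed

lemma coord_in: "coord z \<in> mmaps \<tau> M idx alg"
proof -
  have "coord z \<in> idx \<rightarrow>\<^sub>E carr M"
    by (auto simp: idx_def coord_enc fsfun_in) (simp add: coord_def idx_def)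
  moreover have "{i \<in> idx. coord z i \<in> X} \<in> alg" for X
  proof (rule algI)
    show "sm {z}" unfolding small_def by (rule finite_small) simp
    show "depends fsfun {z} (\<lambda>e. enc e \<in> {i \<in> idx. coord z i \<in> X})"
      by (simp add: depends_def coord_enc idx_def)
  qed auto
  ultimately show ?thesis by (simp add: mmaps_def)
qed

lemma smaps_mmaps:
  assumes "a \<in> mmaps \<tau> M idx alg"
  shows "(\<lambda>e\<in>fsfun. a (enc e)) \<in> smaps"
proof -
  obtain T where T: "sm T" "depends fsfun T (\<lambda>e. a (enc e))" using mmaps_depends[OF assms] by blast
  have "depends fsfun T (\<lambda>e\<in>fsfun. a (enc e))"
    unfolding depends_def
  proof (intro ballI impI)
    fix e e' assume e: "e \<in> fsfun" "e' \<in> fsfun" "\<forall>z\<in>T. e z = e' z"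
    have "a (enc e) = a (enc e')" by (rule dependsD[OF T(2) e(1,2)]) (use e(3) in blast)
    then show "(\<lambda>e\<in>fsfun. a (enc e)) e = (\<lambda>e\<in>fsfun. a (enc e)) e'" using e(1,2) by simp
  qed
  moreover have "(\<lambda>e\<in>fsfun. a (enc e)) \<in> fsfun \<rightarrow>\<^sub>E carr M"
    using assms by (auto simp: mmaps_def idx_def)
  ultimately show ?thesis unfolding smaps_def using T(1) by blast
qed

text \<open>A measurable map \<open>m\<close> is determined by an enumeration \<open>s\<close> of a support and by the values
  of \<open>m\<close> at the functions that vanish off finitely many members of this enumeration.\<close>

lemma ex_code_smaps: "\<exists>C :: (('k name \<Rightarrow> 'a) \<Rightarrow> 'a) \<Rightarrow> 'k set. inj_on C smaps"
proof -
  obtain d :: "'k \<Rightarrow> 'k \<times> 'a" where d: "surj d"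
  proof -
    have "inj (\<lambda>(k, a). code [k, point a])"
      using code point by (auto simp: inj_def)
    then show thesis using that inj_imp_surj_inv by blast
  qed
  \<comment> \<open>Through \<open>d\<close> each entry of \<open>l\<close> is an order (j, x): give
    the coordinate s j the value x. Starting from the constant \<open>x\<^sub>0\<close>, lists reach
    every function that differs from it at finitely many members of \<open>range s\<close>.\<close>
  define E where "E s l = foldr (\<lambda>k e. e(s (fst (d k)) := snd (d k))) l (\<lambda>_. x\<^sub>0)"
    for s :: "'k \<Rightarrow> 'k name" and l
  have E: "\<exists>l. E s l = (\<lambda>z. if z \<in> Z then e z else x\<^sub>0)" if "finite Z" "Z \<subseteq> range s" for s Z and e :: "'k name \<Rightarrow> 'a"
    using that
  proof (induction Z)
    case empty
    then show ?case by (intro exI[of _ "[]"]) (simp add: E_def)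
  next
    case (insert z Z)
    then obtain l where l: "E s l = (\<lambda>z. if z \<in> Z then e z else x\<^sub>0)" by auto
    obtain j where j: "z = s j" using insert.prems by auto
    obtain k where "d k = (j, e z)" using d by (metis surjD)
    then have "E s (k # l) = (E s l)(z := e z)" by (simp add: E_def j)
    also have "\<dots> = (\<lambda>w. if w \<in> insert z Z then e w else x\<^sub>0)" by (auto simp: l)
    finally show ?case by blast
  qed
  have "\<exists>s :: 'k \<Rightarrow> 'k name. depends fsfun (range s) m" if m: "m \<in> smaps" for m
  proof -
    obtain T where T: "sm T" "depends fsfun T m" using m unfolding smaps_def by blast
    have "\<exists>s :: 'k \<Rightarrow> 'k name. T \<subseteq> range s"
    proof (cases "T = {}")
      case False
      then show ?thesis using T(1) card_of_ordLeq2[of T "UNIV :: 'k set"] unfolding small_def by blast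
    qed simp
    then show ?thesis using depends_mono[OF T(2)] by blast
  qed
  then have "\<forall>m\<in>smaps. \<exists>s :: 'k \<Rightarrow> 'k name. depends fsfun (range s) m" by (rule ballI)
  from bchoice[OF this] obtain s :: "(('k name \<Rightarrow> 'a) \<Rightarrow> 'a) \<Rightarrow> 'k \<Rightarrow> 'k name"
    where "\<forall>m\<in>smaps. depends fsfun (range (s m)) m" ..
  note s = bspec[OF this]
  \<comment> \<open>Lists of length 1, 2 and 3 record the three components of the names s m k; the
    four copies of p keep the recorded values of \<open>m\<close> apart from them.\<close>
  define C where "C m = ({[k] |k. fst (s m k)} \<union> {[k, x] |k x. x \<in> fst (snd (s m k))}
    \<union> {[k, x, x] |k x. x \<in> snd (snd (s m k))}
    \<union> {p # p # p # p # l |p l. p = point (m (E (s m) l))} :: 'k list set)" for m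
  have "inj_on C smaps"
  proof (rule inj_onI)
    fix m m' assume m: "m \<in> smaps" "m' \<in> smaps" and eq: "C m = C m'"
    have "s m k = s m' k" for k
    proof -
      have "fst (s m k) = fst (s m' k)" using arg_cong[OF eq, of "\<lambda>C. [k] \<in> C"] by (simp add: C_def)
      moreover have "fst (snd (s m k)) = fst (snd (s m' k))"
      proof (rule set_eqI)
        show "x \<in> fst (snd (s m k)) \<longleftrightarrow> x \<in> fst (snd (s m' k))" for x
          using arg_cong[OF eq, of "\<lambda>C. [k, x] \<in> C"] by (simp add: C_def)
      qed
      moreover have "snd (snd (s m k)) = snd (snd (s m' k))"
      proof (rule set_eqI)
        show "x \<in> snd (snd (s m k)) \<longleftrightarrow> x \<in> snd (snd (s m' k))" for x
          using arg_cong[OF eq, of "\<lambda>C. [k, x, x] \<in> C"] by (simp add: C_def)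
      qed
      ultimately show ?thesis by (simp add: prod_eq_iff)
    qed
    then have ss: "s m = s m'" by (rule ext)
    have val: "m (E (s m) l) = m' (E (s m) l)" for l
    proof -
      let ?p = "point (m (E (s m) l))"
      have "?p # ?p # ?p # ?p # l \<in> C m" by (simp add: C_def)
      then have "?p = point (m' (E (s m) l))" unfolding eq by (simp add: C_def ss)
      then show ?thesis using injD[OF point] by blast
    qed
    show "m = m'"
    proof (rule PiE_ext)
      show "m \<in> fsfun \<rightarrow>\<^sub>E carr M" "m' \<in> fsfun \<rightarrow>\<^sub>E carr M" using m by (auto simp: smaps_def)
      fix e assume e: "e \<in> fsfun"
      \<comment> \<open>Resetting \<open>e\<close> to \<open>x\<^sub>0\<close> off \<open>Z\<close>
        changes nothing on \<open>range (s m)\<close>, so neither map notices it.\<close>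
      define Z where "Z = {z. e z \<noteq> x\<^sub>0} \<inter> range (s m)"
      have "finite Z" using e by (simp add: fsfun_def Z_def)
      then obtain l where l: "E (s m) l = (\<lambda>z. if z \<in> Z then e z else x\<^sub>0)"
        using E[of Z "s m" e] by (auto simp: Z_def)
      have u: "(\<lambda>z. if z \<in> Z then e z else x\<^sub>0) \<in> fsfun"
        using e x\<^sub>0 \<open>finite Z\<close> by (auto simp: fsfun_def elim!: rev_finite_subset)
      have "m e = m (E (s m) l)" unfolding l
        by (rule dependsD[OF s[OF m(1)] e u]) (auto simp: Z_def)
      moreover have "m' e = m' (E (s m) l)" unfolding l
        by (rule dependsD[OF s[OF m(2)] e u]) (auto simp: Z_def ss)
      ultimately show "m e = m' e" using val by simp
    qed
  qed
  then have "inj_on (\<lambda>m. code ` C m) smaps"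
    using inj_image_eq_iff[OF code] by (auto simp: inj_on_def)
  then show ?thesis by blast
qed

text \<open>Every measurable map gets a name with either tag whose rank exceeds the rank of each
  name in a support of the map.\<close>

lemma ex_name_functions:
  "\<exists>f :: 'k name \<Rightarrow> ('k name \<Rightarrow> 'a) \<Rightarrow> 'a. coordinate_side \<tau> M lower fsfun f \<and>
    (\<forall>t. \<forall>a\<in>mmaps \<tau> M idx alg. \<exists>z. fst z = t \<and> (\<forall>e\<in>fsfun. f z e = a (enc e)))"
proof -
  obtain C :: "(('k name \<Rightarrow> 'a) \<Rightarrow> 'a) \<Rightarrow> 'k set" where C: "inj_on C smaps"
    using ex_code_smaps by blast
  define g where "g z = inv_into smaps C (fst (snd z))" for z :: "'k name"
  \<comment> \<open>Names whose first set does not encode a map depending on lower names only demand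
    the constant \<open>x\<^sub>0\<close>; thus every demand looks at lower names.\<close>
  define f where "f z e = (if g z \<in> smaps \<and> depends fsfun {w. (w, z) \<in> lower} (g z) then g z e else x\<^sub>0)" for z e
  have "coordinate_side \<tau> M lower fsfun f"
  proof
    show "f z e \<in> carr M" if "e \<in> fsfun" for z e
      using that x\<^sub>0 by (auto simp: f_def smaps_def)
    show "f z e = f z e'" if "e \<in> fsfun" "e' \<in> fsfun" "\<And>w. (w, z) \<in> lower \<Longrightarrow> e w = e' w" for z e e'
      using that dependsD[of fsfun "{w. (w, z) \<in> lower}" "g z" e e'] by (simp add: f_def)
  qed (use sig str wf_lower fsfun_ne fsfun_in fsfun_upd in auto)
  moreover have "\<exists>z. fst z = t \<and> (\<forall>e\<in>fsfun. f z e = a (enc e))" if a: "a \<in> mmaps \<tau> M idx alg" for t a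
  proof -
    define m where "m = (\<lambda>e\<in>fsfun. a (enc e))"
    have m: "m \<in> smaps" unfolding m_def by (rule smaps_mmaps[OF a])
    then obtain T where T: "sm T" "depends fsfun T m" unfolding smaps_def by blast
    obtain w where w: "T \<subseteq> {v. (v, (t, C m, w)) \<in> lower}" using small_bounded[OF inf T(1)] by blast
    have "g (t, C m, w) = m" unfolding g_def using inv_into_f_f[OF C m] by simp
    then have "f (t, C m, w) e = m e" for e
      using m depends_mono[OF T(2) w] by (simp add: f_def)
    then show ?thesis by (intro exI[of _ "(t, C m, w)"]) (simp add: m_def)
  qed
  ultimately show ?thesis by blast
qed

end

theorem theorem4p6:
  fixes \<tau> :: "('f, 'r, 'c) lsig"
    and M :: "('a, 'f, 'r, 'c) struct"
    and N :: "('b, 'f, 'r, 'c) struct"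
  assumes "is_signature \<tau>"
    and "complete_structure \<tau> M"
    and "complete_structure \<tau> N"
    and "elem_equiv \<tau> M N"
  shows "\<exists>(I :: ('a, 'b) index set) A \<mu> (J :: ('a, 'b) index set) B \<nu>.
    charge_space I A \<mu> \<and> charge_space J B \<nu> \<and>
    meanable \<tau> M A \<and> meanable \<tau> N B \<and>
    isomorphic_structures \<tau> (powermean \<tau> M I A \<mu>) (powermean \<tau> N J B \<nu>)"
proof -
  have str: "is_structure \<tau> M" "is_structure \<tau> N"
    using assms(2,3) by (auto simp: complete_structure_def)
  obtain x y where xy: "x \<in> carr M" "y \<in> carr N"
    using is_structureD(1)[OF str(1)] is_structureD(1)[OF str(2)] by blast
  \<comment> \<open>The summand \<open>nat\<close> makes the type infinite; the other two provide
    the injections of the points.\<close>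
  have inf: "infinite (UNIV :: (nat + 'a + 'b) set)" by (simp add: finite_Plus_UNIV_iff)
  obtain code :: "(nat + 'a + 'b) list \<Rightarrow> nat + 'a + 'b" where code: "inj code"
    using ex_inj_list[OF inf] by blast
  interpret M: finite_support \<tau> M x code "\<lambda>a. Inr (Inl a) :: nat + 'a + 'b"
    using assms(1) str(1) xy(1) code inf by unfold_locales (auto simp: inj_def)
  interpret N: finite_support \<tau> N y code "\<lambda>b. Inr (Inr b) :: nat + 'a + 'b"
    using assms(1) str(2) xy(2) code inf by unfold_locales (auto simp: inj_def)
  obtain f where f: "coordinate_side \<tau> M lower M.fsfun f"
      "\<And>t a. a \<in> mmaps \<tau> M M.idx M.alg \<Longrightarrow> \<exists>z. fst z = t \<and> (\<forall>e\<in>M.fsfun. f z e = a (M.enc e))"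
    using M.ex_name_functions by blast
  obtain g where g: "coordinate_side \<tau> N lower N.fsfun g"
      "\<And>t a. a \<in> mmaps \<tau> N N.idx N.alg \<Longrightarrow> \<exists>z. fst z = t \<and> (\<forall>e\<in>N.fsfun. g z e = a (N.enc e))"
    using N.ex_name_functions by blast
  interpret J: joint_coordinates \<tau> M N lower M.fsfun f N.fsfun g fst
    using f(1) g(1) assms(4) by (intro joint_coordinates.intro joint_coordinates_axioms.intro)
  let ?S = "M.fsfun \<times> N.fsfun"
  obtain L where L: "mean ?S L" "\<And>z. L (J.dev z) = 0"
      "\<And>R ts \<sigma>. fm_ok \<tau> (Rel R ts) \<Longrightarrow> L (J.gap R ts \<sigma>) = 0"
    using J.ex_joint_mean by blast
  let ?\<pi> = "\<lambda>s. M.enc (fst s)" and ?\<rho> = "\<lambda>s. N.enc (snd s)"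
  interpret PM: mean_powermean M.idx M.alg ?S L ?\<pi> \<tau> M
    by (intro mean_powermean.intro mean_charge.intro mean_powermean_axioms.intro
        M.algebra_alg L(1) assms(1) str(1) M.discr) (auto simp: M.idx_def)
  interpret PN: mean_powermean N.idx N.alg ?S L ?\<rho> \<tau> N
    by (intro mean_powermean.intro mean_charge.intro mean_powermean_axioms.intro
        N.algebra_alg L(1) assms(1) str(2) N.discr) (auto simp: N.idx_def)
  interpret two_powermeans M.idx M.alg N.idx N.alg ?S L ?\<pi> ?\<rho> \<tau> M N M.coord N.coord
  proof
    fix a assume a: "a \<in> PM.maps"
    \<comment> \<open>The tag \<open>True\<close> places the demand on the side of \<open>M\<close>,
      so \<open>dev z\<close> is the distance from coordinate \<open>z\<close> to \<open>a\<close>,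
      which the mean kills.\<close>
    obtain z where z: "fst z = True" "\<forall>e\<in>M.fsfun. f z e = a (M.enc e)" using f(2)[OF a] by blast
    have "PM.mdist (M.coord z) a = L (J.dev z)"
      unfolding PM.mdist_def
      by (rule mean_cong[OF L(1) PM.bdd_dist]) (use z in \<open>auto simp: J.dev_def M.coord_enc\<close>)
    then show "\<exists>z. PM.mdist (M.coord z) a = 0" using L(2)[of z] by (intro exI[of _ z]) simp
  next
    fix a assume a: "a \<in> PN.maps"
    obtain z where z: "fst z = False" "\<forall>e\<in>N.fsfun. g z e = a (N.enc e)" using g(2)[OF a] by blast
    have "PN.mdist (N.coord z) a = L (J.dev z)"
      unfolding PN.mdist_def
      by (rule mean_cong[OF L(1) PN.bdd_dist]) (use z in \<open>auto simp: J.dev_def N.coord_enc\<close>)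
    then show "\<exists>z. PN.mdist (N.coord z) a = 0" using L(2)[of z] by (intro exI[of _ z]) simp
  next
    fix R ts and \<sigma> :: "nat \<Rightarrow> (nat + 'a + 'b) name" assume ok: "fm_ok \<tau> (Rel R ts)"
    let ?m = "\<lambda>s. rint M R (map (tm_val M (\<lambda>n. M.coord (\<sigma> n) (?\<pi> s))) ts)"
    let ?n = "\<lambda>s. rint N R (map (tm_val N (\<lambda>n. N.coord (\<sigma> n) (?\<rho> s))) ts)"
    have b: "?m \<in> bdd_funs ?S" "?n \<in> bdd_funs ?S"
      using J.bdd_rint[OF ok, of \<sigma>] by (auto simp: bdd_funs_def M.coord_enc N.coord_enc)
    have "L ?m - L ?n = L (\<lambda>s. ?m s - ?n s)" by (rule mean_diff[OF L(1) b, symmetric])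
    also have "\<dots> = L (J.gap R ts \<sigma>)"
      by (rule mean_cong[OF L(1) bdd_funs_diff[OF b]]) (auto simp: J.gap_def M.coord_enc N.coord_enc)
    finally show "L ?m = L ?n" using L(3)[OF ok] by simp
  qed (rule M.coord_in N.coord_in)+
  show ?thesis
    using PM.charge_space PN.charge_space M.meanable N.meanable isomorphic_powermeans by blast
qed

end
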